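(* Let $K$ be a field. There exists a $(0,1)$-polytope $P$ that has a flag unimodular triangulation but whose toric ideal $I_P$ over $K$ is not generated by quadrics.
   Context: A $(0,1)$-polytope is a polytope $P=\operatorname{conv}(A)\subset[0,1]^d$ with $A\subset\{0,1\}^d$; then $P\cap\mathbb{Z}^d=A$. For a lattice polytope $P\subset\mathbb{R}^d$ with $A=P\cap\mathbb{Z}^d$, let $S_A=K[x_a:a\in A]$ (standard graded) and let $\varphi_A:S_A\to K[t,z_1^{\pm1},\ldots,z_d^{\pm1}]$ be the $K$-algebra homomorphism $x_a\mapsto t z^a$. The toric ideal of $P$ is $I_P=\ker(\varphi_A)$. "Generated by quadrics" means generated by homogeneous polynomials of degree two. Triangulations of a lattice polytope use only lattice points as vertices. A triangulation of a $d$-dimensional lattice polytope is unimodular if every maximal simplex has normalized volume one (that is, $d!$ times its Euclidean volume is $1$). It is flag if every minimal nonface has two vertices. *)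

theory Defs
  imports "HOL-Analysis.Analysis" "HOL-Analysis.Finite_Function_Topology"
begin

text \<open>
  The dimension \<open>d\<close> has to be existentially quantified, so it cannot be a type. The space
  of \<open>d\<close>-dimensional real vectors is the subspace of the real vector space
  \<open>nat \<Rightarrow>\<^sub>0 real\<close> of those vectors that are supported on \<open>{..<d}\<close>. Convexity notions are the
  library's.
\<close>

type_synonym rvec = "nat \<Rightarrow>\<^sub>0 real"

definition Rvecs :: "nat \<Rightarrow> rvec set" where
  "Rvecs d = {v. Poly_Mapping.keys v \<subseteq> {..<d}}"

definition zero_one_points :: "nat \<Rightarrow> rvec set" where
  "zero_one_points d = {v \<in> Rvecs d. \<forall>i. Poly_Mapping.lookup v i \<in> {0, 1}}"

definition zero_one_polytope :: "nat \<Rightarrow> rvec set \<Rightarrow> bool" where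
  "zero_one_polytope d P \<longleftrightarrow> (\<exists>A \<subseteq> zero_one_points d. P = convex hull A)"

definition lattice_points :: "rvec set \<Rightarrow> rvec set" where
  "lattice_points P = {v \<in> P. \<forall>i. Poly_Mapping.lookup v i \<in> \<int>}"

text \<open>Lebesgue measure on \<open>d\<close>-dimensional space, as a product of \<open>d\<close> copies of \<open>lborel\<close>.\<close>

definition euclidean_volume :: "nat \<Rightarrow> rvec set \<Rightarrow> real" where
  "euclidean_volume d S =
     measure (Pi\<^sub>M {..<d} (\<lambda>_. lborel :: real measure))
       ((\<lambda>v. restrict (Poly_Mapping.lookup v) {..<d}) ` S)"

definition normalized_volume :: "nat \<Rightarrow> rvec set \<Rightarrow> real" where
  "normalized_volume d S = fact d * euclidean_volume d S"

text \<open>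
  A triangulation is represented by the vertex sets of all its simplices (of all dimensions,
  the empty one included); the simplex with vertex set \<open>\<sigma>\<close> is \<open>convex hull \<sigma>\<close>.
\<close>

definition triangulation_of :: "rvec set \<Rightarrow> rvec set set \<Rightarrow> bool" where
  "triangulation_of P \<Delta> \<longleftrightarrow>
     finite \<Delta> \<and>
     (\<forall>\<sigma>\<in>\<Delta>. finite \<sigma> \<and> \<sigma> \<subseteq> lattice_points P \<and> \<not> affine_dependent \<sigma>) \<and>
     (\<forall>\<sigma>\<in>\<Delta>. \<forall>\<tau>. \<tau> \<subseteq> \<sigma> \<longrightarrow> \<tau> \<in> \<Delta>) \<and>
     (\<forall>\<sigma>\<in>\<Delta>. \<forall>\<tau>\<in>\<Delta>. (convex hull \<sigma> \<inter> convex hull \<tau>) face_of (convex hull \<sigma>)) \<and>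
     (\<Union>\<sigma>\<in>\<Delta>. convex hull \<sigma>) = P"

text \<open>
  Since the volume is \<open>d\<close>-dimensional, a nonempty polytope in \<open>Rvecs d\<close> with a unimodular
  triangulation has dimension \<open>d\<close>.
\<close>

definition unimodular :: "nat \<Rightarrow> rvec set set \<Rightarrow> bool" where
  "unimodular d \<Delta> \<longleftrightarrow>
     (\<forall>\<sigma>\<in>\<Delta>. (\<forall>\<tau>\<in>\<Delta>. \<not> \<sigma> \<subset> \<tau>) \<longrightarrow> normalized_volume d (convex hull \<sigma>) = 1)"

definition minimal_nonface :: "'v set set \<Rightarrow> 'v set \<Rightarrow> bool" where
  "minimal_nonface \<Delta> M \<longleftrightarrow> M \<subseteq> \<Union>\<Delta> \<and> M \<notin> \<Delta> \<and> (\<forall>N. N \<subset> M \<longrightarrow> N \<in> \<Delta>)"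

definition flag :: "'v set set \<Rightarrow> bool" where
  "flag \<Delta> \<longleftrightarrow> (\<forall>M. minimal_nonface \<Delta> M \<longrightarrow> card M = 2)"

text \<open>
  Polynomials with variables indexed by \<open>'v\<close> are finitely supported functions on the monomials
  \<open>'v \<Rightarrow>\<^sub>0 nat\<close>; their ring structure is the convolution product of \<open>HOL-Library.Poly_Mapping\<close>.
\<close>

type_synonym ('v, 'k) mpoly = "('v \<Rightarrow>\<^sub>0 nat) \<Rightarrow>\<^sub>0 'k"

definition poly_ring :: "'v set \<Rightarrow> ('v, 'k::comm_ring_1) mpoly set" where
  "poly_ring A = {p. \<forall>m \<in> Poly_Mapping.keys p. Poly_Mapping.keys m \<subseteq> A}"

definition homogeneous :: "nat \<Rightarrow> ('v, 'k::comm_ring_1) mpoly \<Rightarrow> bool" where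
  "homogeneous n p \<longleftrightarrow>
     (\<forall>m \<in> Poly_Mapping.keys p. (\<Sum>v\<in>Poly_Mapping.keys m. Poly_Mapping.lookup m v) = n)"

definition ideal_generated ::
  "'v set \<Rightarrow> ('v, 'k::comm_ring_1) mpoly set \<Rightarrow> ('v, 'k) mpoly set" where
  "ideal_generated A G =
     {\<Sum>g\<in>F. h g * g | F h. finite F \<and> F \<subseteq> G \<and> (\<forall>g\<in>F. h g \<in> poly_ring A)}"

definition generated_by_quadrics ::
  "'v set \<Rightarrow> ('v, 'k::comm_ring_1) mpoly set \<Rightarrow> bool" where
  "generated_by_quadrics A I \<longleftrightarrow>
     (\<exists>G \<subseteq> {p \<in> poly_ring A. homogeneous 2 p}. ideal_generated A G = I)"

text \<open>
  Laurent polynomials in \<open>t\<close> (with nonnegative exponents) and \<open>z\<^sub>0, z\<^sub>1, \<dots>\<close> (with integer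
  exponents): a monomial is the pair of its \<open>t\<close>-exponent and its vector of \<open>z\<close>-exponents. For
  \<open>A \<subseteq> Rvecs d\<close>, only \<open>z\<^sub>i\<close> with \<open>i < d\<close> occur in the image of the homomorphism below.
\<close>

type_synonym 'k laurent = "(nat \<times> (nat \<Rightarrow>\<^sub>0 int)) \<Rightarrow>\<^sub>0 'k"

text \<open>The homomorphism of algebras that substitutes \<open>x v\<close> for the variable \<open>v\<close>:\<close>

definition subst_hom :: "('v \<Rightarrow> 'k laurent) \<Rightarrow> ('v, 'k::comm_ring_1) mpoly \<Rightarrow> 'k laurent" where
  "subst_hom x p =
     (\<Sum>m\<in>Poly_Mapping.keys p. Poly_Mapping.single 0 (Poly_Mapping.lookup p m) *
        (\<Prod>v\<in>Poly_Mapping.keys m. x v ^ Poly_Mapping.lookup m v))"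

text \<open>
  The monomial \<open>t z\<^sup>a\<close> for a lattice point \<open>a\<close>; as \<open>a\<close> has integer coordinates, \<open>floor\<close> only
  converts their type.
\<close>

definition t_z :: "rvec \<Rightarrow> 'k::comm_ring_1 laurent" where
  "t_z a = Poly_Mapping.single (1, Poly_Mapping.map floor a) 1"

definition toric_ideal :: "rvec set \<Rightarrow> (rvec, 'k::comm_ring_1) mpoly set" where
  "toric_ideal P = {p \<in> poly_ring (lattice_points P). subst_hom t_z p = 0}"

end

theory Submission
  imports Defs
begin

text \<open>
  Let \<open>A\<close> be the set of lattice points of a polytope, and suppose it has a flag unimodular
  triangulation. For every non-edge \<open>{a, b}\<close> there is a unique edge (or vertex) \<open>{a', b'}\<close> with
  \<open>a + b = a' + b'\<close>, so the toric ideal contains the quadric \<open>x\<^bsub>a\<^esub> x\<^bsub>b\<^esub> - x\<^bsub>a'\<^esub> x\<^bsub>b'\<^esub>\<close>, and every monomial whose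
  support is not a face can be rewritten by one of these quadrics. If the triangulation is regular,
  the rewriting strictly decreases a weight, terminates at a monomial supported on a face, and the
  quadrics generate the ideal. If the triangulation is not regular, the rewriting may run in a cycle,
  and a counterexample is a cycle that no quadric leaves.
  
  The counterexample lives in dimension 5, with coordinates numbered from 0. Write \<open>e\<^bsub>I\<^esub>\<close> for the
  \<open>(0,1)\<close>-vector with support \<open>I\<close>. The configuration consists of the 13 points
  \<open>0\<close>, \<open>e\<^bsub>01234\<^esub>\<close>, \<open>e\<^bsub>0\<^esub>\<close>, \<open>e\<^bsub>1\<^esub>\<close>, \<open>e\<^bsub>2\<^esub>\<close>, \<open>e\<^bsub>3\<^esub>\<close>, \<open>e\<^bsub>4\<^esub>\<close>, \<open>e\<^bsub>01\<^esub>\<close>, \<open>e\<^bsub>02\<^esub>\<close>, \<open>e\<^bsub>013\<^esub>\<close>, \<open>e\<^bsub>014\<^esub>\<close>, \<open>e\<^bsub>023\<^esub>\<close>, \<open>e\<^bsub>024\<^esub>\<close>.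
  Among the triples of points with sum \<open>(1,1,1,1,1)\<close> there are the four
  \<open>{e\<^bsub>1\<^esub>, e\<^bsub>3\<^esub>, e\<^bsub>024\<^esub>}\<close>, \<open>{e\<^bsub>1\<^esub>, e\<^bsub>4\<^esub>, e\<^bsub>023\<^esub>}\<close>, \<open>{e\<^bsub>2\<^esub>, e\<^bsub>4\<^esub>, e\<^bsub>013\<^esub>}\<close>, \<open>{e\<^bsub>2\<^esub>, e\<^bsub>3\<^esub>, e\<^bsub>014\<^esub>}\<close>.
  In the triangulation below each of them contains exactly one non-edge (\<open>{e\<^bsub>3\<^esub>, e\<^bsub>024\<^esub>}\<close>, \<open>{e\<^bsub>1\<^esub>, e\<^bsub>023\<^esub>}\<close>,
  \<open>{e\<^bsub>4\<^esub>, e\<^bsub>013\<^esub>}\<close>, \<open>{e\<^bsub>2\<^esub>, e\<^bsub>014\<^esub>}\<close>), and rewriting it yields the next triple, cyclically. No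
  replacement of two members of a triple by two points of the configuration with the same sum leads
  out of these four. On the other hand \<open>e\<^bsub>01234\<^esub> + 0 + 0\<close> is the same sum, and it is supported on a
  face. The sum of the coefficients over the four monomials vanishes on every ideal generated by
  quadrics of the toric ideal, by \<open>sum_coefficients_quadric_multiple\<close>, but not on the cubic binomial
  \<open>x\<^bsub>e1\<^esub> x\<^bsub>e3\<^esub> x\<^bsub>e024\<^esub> - x\<^bsub>e01234\<^esub> x\<^bsub>0\<^esub> x\<^bsub>0\<^esub>\<close>.
  
  Every maximal simplex of the triangulation contains both \<open>0\<close> and \<open>(1,1,1,1,1)\<close>. Modulo the line
  through these two points its remaining four vertices span a cone, and the 29 cones obtained in this
  way form a complete fan in a four-dimensional space. That the cones fill the space is read off a
  decision tree whose leaves are the cones (\<open>tree_certified_sound\<close>), that they meet along common faces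
  follows from separating linear forms (\<open>simplices_meet\<close>), that the simplices are unimodular follows
  from integral dual bases (\<open>normalized_volume_unimodular_simplex\<close>), and that the complex is flag
  is an enumeration of cliques (\<open>cliques_covered_sound\<close>).
\<close>

section \<open>Simplices in a real vector space\<close>

lemma barycentric_unique:
  fixes T :: "'a::real_vector set"
  assumes "\<not> affine_dependent T" "finite T" "sum u T = sum v T"
    "(\<Sum>a\<in>T. u a *\<^sub>R a) = (\<Sum>a\<in>T. v a *\<^sub>R a)" "a \<in> T"
  shows "u a = v a"
proof -
  have "sum (\<lambda>x. u x - v x) T = 0" "(\<Sum>x\<in>T. (u x - v x) *\<^sub>R x) = 0"
    using assms by (auto simp: sum_subtractf scaleR_diff_left)
  then have "\<forall>x\<in>T. u x - v x = 0"
    using assms(1) affine_dependent_explicit_finite[OF assms(2)] by blast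
  then show ?thesis using assms(5) by auto
qed

text \<open>
  Faces of a simplex are recognised by vanishing barycentric coordinates. Taking all coordinates with
  respect to the full vertex set \<open>T\<close> makes points of different faces comparable.
\<close>

lemma convex_hull_subset_coordinates:
  fixes T :: "'a::real_vector set"
  assumes "finite T" "S \<subseteq> T"
  shows "x \<in> convex hull S \<longleftrightarrow>
    (\<exists>u. (\<forall>a\<in>T. 0 \<le> u a) \<and> (\<forall>a\<in>T - S. u a = 0) \<and> sum u T = 1 \<and> (\<Sum>a\<in>T. u a *\<^sub>R a) = x)"
    (is "?l \<longleftrightarrow> ?r")
proof
  have S: "finite S" using assms finite_subset by blast
  assume ?l
  then obtain u where u: "\<forall>a\<in>S. 0 \<le> u a" "sum u S = 1" "(\<Sum>a\<in>S. u a *\<^sub>R a) = x"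
    unfolding convex_hull_finite[OF S] by auto
  let ?v = "\<lambda>a. if a \<in> S then u a else 0"
  have "sum ?v T = 1"
    using u(2) sum.mono_neutral_cong_right[OF assms(1,2), of ?v u] by auto
  moreover have "(\<Sum>a\<in>T. ?v a *\<^sub>R a) = x"
    using u(3) sum.mono_neutral_cong_right[OF assms(1,2), of "\<lambda>a. ?v a *\<^sub>R a" "\<lambda>a. u a *\<^sub>R a"] by auto
  ultimately show ?r using u(1) by (intro exI[of _ ?v]) auto
next
  have S: "finite S" using assms finite_subset by blast
  assume ?r
  then obtain u where u: "\<forall>a\<in>T. 0 \<le> u a" "\<forall>a\<in>T - S. u a = 0" "sum u T = 1"
    "(\<Sum>a\<in>T. u a *\<^sub>R a) = x" by auto
  have "sum u T = sum u S" "(\<Sum>a\<in>T. u a *\<^sub>R a) = (\<Sum>a\<in>S. u a *\<^sub>R a)"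
    using u(2) by (auto intro!: sum.mono_neutral_right assms)
  then show ?l
    unfolding convex_hull_finite[OF S] using u assms(2) by (auto intro!: exI[of _ u])
qed

lemma convex_hull_face_of_simplex:
  fixes T :: "'a::real_vector set"
  assumes T: "\<not> affine_dependent T" "finite T" and "S \<subseteq> T"
  shows "convex hull S face_of convex hull T"
  unfolding face_of_def
proof (intro conjI ballI impI)
  show "convex hull S \<subseteq> convex hull T" using assms(3) by (rule hull_mono)
  show "convex (convex hull S)" by simp
next
  fix b c x
  assume b: "b \<in> convex hull T" and c: "c \<in> convex hull T" and x: "x \<in> convex hull S"
    and "x \<in> open_segment b c"
  then obtain t where t: "0 < t" "t < 1" "x = (1 - t) *\<^sub>R b + t *\<^sub>R c"
    by (auto simp: in_segment)
  note coord = convex_hull_subset_coordinates[OF T(2)]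
  obtain u where u: "\<forall>a\<in>T. 0 \<le> u a" "sum u T = 1" "(\<Sum>a\<in>T. u a *\<^sub>R a) = b"
    using b coord[OF subset_refl] by auto
  obtain v where v: "\<forall>a\<in>T. 0 \<le> v a" "sum v T = 1" "(\<Sum>a\<in>T. v a *\<^sub>R a) = c"
    using c coord[OF subset_refl] by auto
  obtain w where w: "\<forall>a\<in>T - S. w a = 0" "sum w T = 1" "(\<Sum>a\<in>T. w a *\<^sub>R a) = x"
    using x coord[OF assms(3)] by auto
  let ?m = "\<lambda>a. (1 - t) * u a + t * v a"
  have "sum ?m T = 1"
    by (simp add: sum.distrib u v flip: sum_distrib_left)
  moreover have "(\<Sum>a\<in>T. ?m a *\<^sub>R a) = x"
    by (simp add: scaleR_add_left sum.distrib t(3) flip: scaleR_scaleR scaleR_right.sum u(3) v(3))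
  ultimately have m: "w a = ?m a" if "a \<in> T" for a
    using barycentric_unique[OF T, of w ?m] w that by simp
  have "u a = 0 \<and> v a = 0" if "a \<in> T - S" for a
  proof -
    have "(1 - t) * u a + t * v a = 0" "0 \<le> (1 - t) * u a" "0 \<le> t * v a"
      using m[of a] w(1) that t u(1) v(1) by auto
    then have "(1 - t) * u a = 0" "t * v a = 0" by linarith+
    then show ?thesis using t by auto
  qed
  then show "b \<in> convex hull S" "c \<in> convex hull S"
    using u v coord[OF assms(3)] by auto
qed

lemma convex_hull_Int_simplex:
  fixes T :: "'a::real_vector set"
  assumes T: "\<not> affine_dependent T" "finite T" and "S \<subseteq> T" "S' \<subseteq> T"
  shows "convex hull S \<inter> convex hull S' \<subseteq> convex hull (S \<inter> S')"
proof
  note coord = convex_hull_subset_coordinates[OF T(2)]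
  fix x assume x: "x \<in> convex hull S \<inter> convex hull S'"
  obtain u where u: "\<forall>a\<in>T. 0 \<le> u a" "\<forall>a\<in>T-S. u a = 0" "sum u T = 1" "(\<Sum>a\<in>T. u a *\<^sub>R a) = x"
    using x coord[OF assms(3)] by auto
  obtain v where v: "\<forall>a\<in>T-S'. v a = 0" "sum v T = 1" "(\<Sum>a\<in>T. v a *\<^sub>R a) = x"
    using x coord[OF assms(4)] by auto
  have "u a = v a" if "a \<in> T" for a
    using barycentric_unique[OF T, of u v] u v that by simp
  then have "\<forall>a\<in>T - S \<inter> S'. u a = 0" using u(2) v(1) by auto
  then show "x \<in> convex hull (S \<inter> S')"
    using u coord[of "S \<inter> S'"] assms(3) by auto
qed

text \<open>
  A point at which a form attains its minimum over a polytope only involves the vertices at which the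
  form attains it.
\<close>

lemma convex_hull_zero_part:
  fixes S :: "'a::real_vector set"
  assumes "finite S" "linear f" "\<forall>a\<in>S. (0::real) \<le> f a" "x \<in> convex hull S" "f x \<le> 0"
  shows "x \<in> convex hull {a \<in> S. f a = 0}"
proof -
  obtain u where u: "\<forall>a\<in>S. 0 \<le> u a" "sum u S = 1" "(\<Sum>a\<in>S. u a *\<^sub>R a) = x"
    using assms(4) unfolding convex_hull_finite[OF assms(1)] by auto
  have "f x = (\<Sum>a\<in>S. u a * f a)"
    using assms(2) by (simp add: linear_sum linear_scale flip: u(3))
  moreover have nn: "0 \<le> u a * f a" if "a \<in> S" for a using u(1) assms(3) that by auto
  ultimately have "(\<Sum>a\<in>S. u a * f a) = 0"
    using assms(5) sum_nonneg[of S "\<lambda>a. u a * f a", OF nn] by simp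
  then have "\<forall>a\<in>S. u a * f a = 0"
    using sum_nonneg_eq_0_iff[OF assms(1) nn] by simp
  then have "\<forall>a\<in>S - {a \<in> S. f a = 0}. u a = 0" by auto
  then show ?thesis
    using u convex_hull_subset_coordinates[OF assms(1), of "{a \<in> S. f a = 0}"] by auto
qed

lemma linear_ge_on_convex_hull:
  fixes f :: "'a::real_vector \<Rightarrow> real"
  assumes "linear f" "\<And>a. a \<in> S \<Longrightarrow> c \<le> f a" "x \<in> convex hull S"
  shows "c \<le> f x"
proof -
  have "convex {x. c \<le> f x}"
    using convex_linear_vimage[OF assms(1), of "{c..}"] by (simp add: vimage_def)
  then have "convex hull S \<subseteq> {x. c \<le> f x}" using assms(2) by (intro hull_minimal) auto
  then show ?thesis using assms(3) by auto
qed

text \<open>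
  It suffices to control the intersections of the maximal simplices of a complex: inside a single
  simplex the faces intersect in the right way, so the condition passes to all faces.
\<close>

lemma face_to_face:
  fixes T T' :: "'a::real_vector set"
  assumes T: "\<not> affine_dependent T" "finite T" and T': "\<not> affine_dependent T'" "finite T'"
    and meet: "convex hull T \<inter> convex hull T' \<subseteq> convex hull (T \<inter> T')"
    and "S \<subseteq> T" "S' \<subseteq> T'"
  shows "(convex hull S \<inter> convex hull S') face_of convex hull S"
proof -
  have "convex hull S \<inter> convex hull S' \<subseteq> convex hull (S \<inter> S')"
  proof
    fix x assume x: "x \<in> convex hull S \<inter> convex hull S'"
    then have "x \<in> convex hull T" "x \<in> convex hull T'"
      using hull_mono[OF \<open>S \<subseteq> T\<close>, of convex] hull_mono[OF \<open>S' \<subseteq> T'\<close>, of convex] by auto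
    then have TT: "x \<in> convex hull (T \<inter> T')" using meet by auto
    have "x \<in> convex hull (S \<inter> (T \<inter> T'))"
      using convex_hull_Int_simplex[OF T \<open>S \<subseteq> T\<close>, of "T \<inter> T'"] x TT by auto
    moreover have "x \<in> convex hull (S' \<inter> (T \<inter> T'))"
      using convex_hull_Int_simplex[OF T' \<open>S' \<subseteq> T'\<close>, of "T \<inter> T'"] x TT by auto
    ultimately have "x \<in> convex hull ((S \<inter> (T \<inter> T')) \<inter> (S' \<inter> (T \<inter> T')))"
      using convex_hull_Int_simplex[OF T, of "S \<inter> (T \<inter> T')" "S' \<inter> (T \<inter> T')"] by auto
    moreover have "(S \<inter> (T \<inter> T')) \<inter> (S' \<inter> (T \<inter> T')) = S \<inter> S'"
      using \<open>S \<subseteq> T\<close> \<open>S' \<subseteq> T'\<close> by auto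
    ultimately show "x \<in> convex hull (S \<inter> S')" by simp
  qed
  moreover have "convex hull (S \<inter> S') \<subseteq> convex hull S \<inter> convex hull S'"
    by (simp add: hull_mono)
  ultimately have "convex hull S \<inter> convex hull S' = convex hull (S \<inter> S')" by blast
  moreover have "\<not> affine_dependent S"
    using T(1) \<open>S \<subseteq> T\<close> affine_independent_subset by blast
  ultimately show ?thesis
    using convex_hull_face_of_simplex[of S "S \<inter> S'"] T(2) \<open>S \<subseteq> T\<close> finite_subset by auto
qed

section \<open>The volume of a unimodular simplex\<close>

text \<open>
  The volume of a simplex is known on \<open>real ^ 'n\<close>, whereas a dimension that is a number needs a
  product of copies of \<open>lborel\<close>. A bijection \<open>idx\<close> between the index type and \<open>{..<d}\<close> carries one
  to the other.
\<close>

lemma borel_measurable_reindex: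
  fixes idx :: "'n::finite \<Rightarrow> nat"
  assumes "\<And>i. idx i < d"
  shows "(\<lambda>y. \<chi> i. y (idx i)) \<in> borel_measurable (Pi\<^sub>M {..<d} (\<lambda>_. lborel :: real measure))"
proof (rule borel_measurable_euclidean_space[THEN iffD2], rule ballI)
  fix b :: "real ^ 'n" assume "b \<in> Basis"
  then obtain i where "b = axis i 1" by (auto simp: Basis_vec_def)
  then show "(\<lambda>y. (\<chi> i. y (idx i)) \<bullet> b) \<in> borel_measurable (Pi\<^sub>M {..<d} (\<lambda>_. lborel :: real measure))"
    using assms measurable_component_singleton[of "idx i" "{..<d}" "\<lambda>_. lborel :: real measure"]
    by (simp add: cart_eq_inner_axis[symmetric])
qed

lemma lborel_vec_eq_distr_PiM:
  fixes idx :: "'n::finite \<Rightarrow> nat"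
  assumes idx: "bij_betw idx UNIV {..<d}"
  shows "(lborel :: (real ^ 'n) measure) =
    distr (Pi\<^sub>M {..<d} (\<lambda>_. lborel)) borel (\<lambda>y. \<chi> i. y (idx i))" (is "_ = ?M")
proof (rule lborel_eqI)
  interpret product_sigma_finite "\<lambda>_::nat. lborel :: real measure" by standard
  have idx_in: "idx i < d" for i using idx by (auto simp: bij_betw_def)
  note meas = borel_measurable_reindex[of idx d, OF idx_in]
  fix l u :: "real ^ 'n"
  assume lu: "\<And>b. b \<in> Basis \<Longrightarrow> l \<bullet> b \<le> u \<bullet> b"
  have le: "l $ i \<le> u $ i" for i
    using lu[of "axis i 1"] by (simp add: cart_eq_inner_axis axis_in_Basis_iff)
  define inv_idx where "inv_idx = the_inv_into UNIV idx"
  have inv: "inv_idx (idx i) = i" for i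
    using idx by (simp add: inv_idx_def bij_betw_def the_inv_into_f_f)
  have inv': "idx (inv_idx k) = k" if "k < d" for k
    using idx that by (metis bij_betw_def f_the_inv_into_f inv_idx_def lessThan_iff)
  have "(\<lambda>y. \<chi> i. y (idx i)) -` box l u \<inter> space (Pi\<^sub>M {..<d} (\<lambda>_. lborel :: real measure)) =
      (\<Pi>\<^sub>E k\<in>{..<d}. {l $ inv_idx k <..< u $ inv_idx k})"
    (is "?L = ?R")
  proof
    show "?L \<subseteq> ?R"
    proof
      fix y assume y: "y \<in> ?L"
      then have "\<And>i. l $ i < y (idx i) \<and> y (idx i) < u $ i" by (simp add: mem_box_cart)
      then have "l $ inv_idx k < y k \<and> y k < u $ inv_idx k" if "k < d" for k
        using inv'[OF that] by metis
      then show "y \<in> ?R" using y by (auto simp: space_PiM PiE_def)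
    qed
    show "?R \<subseteq> ?L"
    proof
      fix y assume y: "y \<in> ?R"
      then have "l $ i < y (idx i) \<and> y (idx i) < u $ i" for i
        using idx_in[of i] inv[of i] by (auto simp: PiE_def Pi_def)
      then show "y \<in> ?L" using y by (auto simp: space_PiM PiE_def mem_box_cart)
    qed
  qed
  then have "emeasure ?M (box l u) = (\<Prod>k<d. emeasure lborel {l $ inv_idx k <..< u $ inv_idx k})"
    by (simp add: emeasure_distr[OF meas] emeasure_PiM)
  also have "\<dots> = (\<Prod>k<d. ennreal (u $ inv_idx k - l $ inv_idx k))"
    using le by simp
  also have "\<dots> = (\<Prod>i\<in>UNIV. ennreal (u $ i - l $ i))"
    by (rule prod.reindex_bij_betw[OF idx, symmetric, THEN trans]) (simp add: inv)
  also have "\<dots> = ennreal (\<Prod>i\<in>UNIV. u $ i - l $ i)"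
    using le by (simp add: prod_ennreal)
  also have "(\<Prod>i\<in>UNIV. u $ i - l $ i) = (\<Prod>b\<in>Basis. (u - l) \<bullet> b)"
    by (rule prod.reindex_cong[symmetric, where l="\<lambda>i. axis i 1"])
      (auto simp: Basis_vec_def inj_on_def axis_eq_axis cart_eq_inner_axis inner_diff_left)
  finally show "emeasure ?M (box l u) = (\<Prod>b\<in>Basis. (u - l) \<bullet> b)" .
qed simp

definition to_vec :: "('n::finite \<Rightarrow> nat) \<Rightarrow> rvec \<Rightarrow> real ^ 'n" where
  "to_vec idx v = (\<chi> i. Poly_Mapping.lookup v (idx i))"

lemma lookup_scaleR [simp]: "Poly_Mapping.lookup (c *\<^sub>R x) i = c * Poly_Mapping.lookup (x :: rvec) i"
proof -
  have "finite {i. c * Poly_Mapping.lookup x i \<noteq> 0}"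
    by (rule finite_subset[of _ "Poly_Mapping.keys x"]) (auto simp: in_keys_iff)
  then show ?thesis by (simp add: scaleR_poly_mapping_def Abs_poly_mapping_inverse)
qed

lemma linear_to_vec: "linear (to_vec idx)"
  by (rule linearI) (simp_all add: to_vec_def vec_eq_iff lookup_add)

lemma euclidean_volume_eq_content:
  fixes idx :: "'n::finite \<Rightarrow> nat"
  assumes idx: "bij_betw idx UNIV {..<d}" and S: "to_vec idx ` S \<in> sets borel"
  shows "euclidean_volume d S = measure lborel (to_vec idx ` S)"
proof -
  let ?M = "Pi\<^sub>M {..<d} (\<lambda>_. lborel :: real measure)" and ?f = "\<lambda>y. \<chi> i. y (idx i)"
  have idx_in: "idx i < d" for i using idx by (auto simp: bij_betw_def)
  have surj: "\<exists>i. k = idx i" if "k < d" for k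
    using idx that by (metis bij_betw_def imageE lessThan_iff)
  have "?f -` (to_vec idx ` S) \<inter> space ?M = (\<lambda>v. restrict (Poly_Mapping.lookup v) {..<d}) ` S"
  proof (intro equalityI subsetI)
    fix y assume y: "y \<in> ?f -` (to_vec idx ` S) \<inter> space ?M"
    then obtain v where v: "v \<in> S" "\<And>i. y (idx i) = Poly_Mapping.lookup v (idx i)"
      by (auto simp: to_vec_def vec_eq_iff)
    have "y = restrict (Poly_Mapping.lookup v) {..<d}"
    proof
      fix k
      show "y k = restrict (Poly_Mapping.lookup v) {..<d} k"
        using v(2) surj[of k] y by (cases "k < d") (auto simp: space_PiM PiE_def extensional_def)
    qed
    then show "y \<in> (\<lambda>v. restrict (Poly_Mapping.lookup v) {..<d}) ` S" using v(1) by blast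
  next
    fix y assume "y \<in> (\<lambda>v. restrict (Poly_Mapping.lookup v) {..<d}) ` S"
    then show "y \<in> ?f -` (to_vec idx ` S) \<inter> space ?M"
      using idx_in by (auto simp: to_vec_def space_PiM split: if_splits)
  qed
  moreover have "?f \<in> borel_measurable ?M"
    using idx_in by (rule borel_measurable_reindex)
  ultimately show ?thesis
    unfolding lborel_vec_eq_distr_PiM[OF idx] using S
    by (simp add: measure_distr euclidean_volume_def)
qed

lemma det_Ints: "(\<And>i j. M $ i $ j \<in> \<int>) \<Longrightarrow> det (M :: real ^ 'n ^ 'n) \<in> \<int>"
  unfolding det_def by (intro Ints_sum Ints_mult Ints_prod) auto

text \<open>
  Both determinants are integers with product 1, so the determinant need not be computed.
\<close>

lemma abs_det_eq_1_if_integral_inverse: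
  fixes M N :: "real ^ 'n ^ 'n"
  assumes "\<And>i j. M $ i $ j \<in> \<int>" "\<And>i j. N $ i $ j \<in> \<int>" "N ** M = mat 1"
  shows "\<bar>det M\<bar> = 1"
proof -
  obtain m n :: int where mn: "det M = of_int m" "det N = of_int n"
    using det_Ints[of M] det_Ints[of N] assms(1,2) by (auto elim!: Ints_cases)
  have "det N * det M = 1" using assms(3) by (metis det_I det_mul)
  then have "(of_int (m * n) :: real) = of_int 1" by (simp add: mn mult.commute)
  then have "m * n = 1" by (simp only: of_int_eq_iff)
  then have "\<bar>m\<bar> = 1" using zmult_eq_1_iff[of m n] by auto
  then show ?thesis by (simp add: mn flip: of_int_abs)
qed

text \<open>
  The rows \<open>w i\<close> form an integral dual basis of the vertices \<open>v j\<close>: this certifies that the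
  vertices are a basis of the integer lattice.
\<close>

lemma normalized_volume_unimodular_simplex:
  fixes idx :: "'n::{finite,wellorder} \<Rightarrow> nat" and v :: "'n \<Rightarrow> rvec" and w :: "'n \<Rightarrow> nat \<Rightarrow> int"
  assumes idx: "bij_betw idx UNIV {..<d}"
    and int: "\<And>i k. Poly_Mapping.lookup (v i) k \<in> \<int>"
    and dual: "\<And>i j. (\<Sum>k<d. of_int (w i k) * Poly_Mapping.lookup (v j) k) = (if i = j then 1 else 0)"
  shows "normalized_volume d (convex hull (insert 0 (range v))) = 1"
proof -
  define f where "f = to_vec idx \<circ> v"
  define M :: "real ^ 'n::_ ^ 'n::_" where "M = (\<chi> i j. f j $ i - 0 $ i)"
  define N :: "real ^ 'n::_ ^ 'n::_" where "N = (\<chi> i j. of_int (w i (idx j)))"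
  have prod: "(\<Sum>k\<in>UNIV. N $ i $ k * f j $ k) = (if i = j then 1 else 0)" for i j
  proof -
    have "(\<Sum>k\<in>UNIV. N $ i $ k * f j $ k) =
        (\<Sum>k\<in>UNIV. (\<lambda>k. of_int (w i k) * Poly_Mapping.lookup (v j) k) (idx k))"
      by (simp add: N_def f_def to_vec_def)
    also have "\<dots> = (\<Sum>k<d. of_int (w i k) * Poly_Mapping.lookup (v j) k)"
      by (rule sum.reindex_bij_betw[OF idx])
    finally show ?thesis using dual by simp
  qed
  then have NM: "N ** M = mat 1"
    by (simp add: matrix_matrix_mult_def mat_def vec_eq_iff M_def)
  have col: "N *v f j = axis j 1" for j
    using prod by (simp add: matrix_vector_mult_def axis_def vec_eq_iff)
  have inj: "inj f"
  proof (rule injI)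
    fix i j assume "f i = f j"
    then have "axis i (1 :: real) = axis j 1" by (simp flip: col)
    then show "i = j" by (simp add: axis_eq_axis)
  qed
  have nz: "0 \<notin> range f"
  proof
    assume "0 \<in> range f"
    then obtain j where "f j = 0" by auto
    then have "axis j (1 :: real) = 0" by (simp flip: col)
    then show False by simp
  qed
  let ?X = "insert 0 (range f)"
  have "convex hull ?X = to_vec idx ` (convex hull (insert 0 (range v)))"
    using linear_to_vec[of idx]
    by (simp add: convex_hull_linear_image image_image f_def linear_0)
  moreover have "convex hull ?X \<in> sets borel"
    by (intro borel_closed compact_imp_closed finite_imp_compact_convex_hull) auto
  ultimately have "euclidean_volume d (convex hull (insert 0 (range v))) = measure lborel (convex hull ?X)"
    using euclidean_volume_eq_content[OF idx] by simp
  also have "\<dots> = \<bar>det M\<bar> / fact CARD('n)"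
    unfolding M_def
  proof (rule content_simplex)
    show "card ?X = Suc CARD('n)" using nz inj by (simp add: card_image)
    show "bij_betw f UNIV (?X - {0})" using nz inj by (simp add: bij_betw_def)
  qed auto
  also have "\<bar>det M\<bar> = 1"
    using NM int by (intro abs_det_eq_1_if_integral_inverse[of M N])
      (auto simp: M_def N_def f_def to_vec_def)
  also have "CARD('n) = d" using bij_betw_same_card[OF idx] by simp
  finally show ?thesis by (simp add: normalized_volume_def)
qed

section \<open>Toric ideals and quadratic moves\<close>

text \<open>
  Multisets of variables are the monomials in a form that supports size, images and inclusion.
\<close>

definition monomial :: "'v multiset \<Rightarrow> 'v \<Rightarrow>\<^sub>0 nat" where
  "monomial M = Abs_poly_mapping (count M)"

lemma lookup_monomial [simp]: "Poly_Mapping.lookup (monomial M) = count M"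
  by (simp add: monomial_def Abs_poly_mapping_inverse flip: set_mset_def)

lemma keys_monomial [simp]: "Poly_Mapping.keys (monomial M) = set_mset M"
  by (auto simp: in_keys_iff)

lemma monomial_union: "monomial (M + N) = monomial M + monomial N"
  by (rule poly_mapping_eqI) (simp add: lookup_add)

lemma monomial_eq_iff: "monomial M = monomial N \<longleftrightarrow> M = N"
  by (metis lookup_monomial count_inject)

lemma monomial_cases: obtains M where "m = monomial M"
proof
  have "finite {x. 0 < Poly_Mapping.lookup m x}" by simp
  then show "m = monomial (Abs_multiset (Poly_Mapping.lookup m))"
    by (intro poly_mapping_eqI) (simp add: Abs_multiset_inverse)
qed

definition toric_exponent :: "rvec multiset \<Rightarrow> nat \<times> (nat \<Rightarrow>\<^sub>0 int)" where
  "toric_exponent M = (size M, \<Sum>a\<in>#M. Poly_Mapping.map floor a)"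

lemma prod_t_z:
  "(\<Prod>v\<in>Poly_Mapping.keys (monomial M). (t_z v :: 'k::comm_ring_1 laurent) ^ Poly_Mapping.lookup (monomial M) v) =
    Poly_Mapping.single (toric_exponent M) 1"
proof -
  have "(\<Prod>a\<in>#M. (t_z a :: 'k laurent)) = Poly_Mapping.single (toric_exponent M) 1"
  proof (induction M)
    case empty
    have "(0, 0) = (0 :: nat \<times> (nat \<Rightarrow>\<^sub>0 int))" by (simp add: zero_prod_def)
    then show ?case by (simp add: toric_exponent_def)
  next
    case (add a M)
    then show ?case by (simp add: t_z_def toric_exponent_def mult_single)
  qed
  then show ?thesis by (simp add: image_prod_mset_multiplicity)
qed

text \<open>
  The monomials with a given toric exponent \<open>e\<close> form a fibre. An element of the toric ideal is
  therefore a polynomial whose coefficients have sum zero over each fibre.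
\<close>

lemma lookup_subst_hom:
  fixes p :: "(rvec, 'k::comm_ring_1) mpoly"
  assumes "finite S" "Poly_Mapping.keys p \<subseteq> monomial ` S"
  shows "Poly_Mapping.lookup (subst_hom t_z p) e =
    (\<Sum>M | M \<in> S \<and> toric_exponent M = e. Poly_Mapping.lookup p (monomial M))"
proof -
  let ?f = "\<lambda>m. Poly_Mapping.single 0 (Poly_Mapping.lookup p m) *
        (\<Prod>v\<in>Poly_Mapping.keys m. t_z v ^ Poly_Mapping.lookup m v)"
  have "subst_hom t_z p = sum ?f (monomial ` S)"
    unfolding subst_hom_def using assms by (intro sum.mono_neutral_left) (auto simp: in_keys_iff)
  also have "\<dots> = (\<Sum>M\<in>S. ?f (monomial M))"
    by (intro sum.reindex_cong[of monomial]) (auto simp: inj_on_def monomial_eq_iff)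
  also have "\<dots> = (\<Sum>M\<in>S. Poly_Mapping.single (toric_exponent M) (Poly_Mapping.lookup p (monomial M)))"
    by (simp only: prod_t_z mult_single) simp
  finally have "Poly_Mapping.lookup (subst_hom t_z p) e =
      (\<Sum>M\<in>S. if toric_exponent M = e then Poly_Mapping.lookup p (monomial M) else 0)"
    by (simp add: lookup_sum lookup_single when_def)
  also have "\<dots> = (\<Sum>M | M \<in> S \<and> toric_exponent M = e. Poly_Mapping.lookup p (monomial M))"
    using assms(1) by (simp add: sum.inter_filter)
  finally show ?thesis .
qed

lemma sum_lookup_mult:
  fixes g h :: "('v, 'k::comm_ring_1) mpoly"
  assumes "finite C"
  shows "(\<Sum>m\<in>C. Poly_Mapping.lookup (h * g) m) =
    (\<Sum>u\<in>Poly_Mapping.keys h. Poly_Mapping.lookup h u *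
      (\<Sum>q | q \<in> Poly_Mapping.keys g \<and> u + q \<in> C. Poly_Mapping.lookup g q))"
proof -
  have expand: "p = (\<Sum>m\<in>Poly_Mapping.keys p. Poly_Mapping.single m (Poly_Mapping.lookup p m))"
    for p :: "('v, 'k) mpoly"
    by (rule poly_mapping_eqI)
      (simp add: lookup_sum lookup_single when_def in_keys_iff sum.delta)
  have "h * g = (\<Sum>u\<in>Poly_Mapping.keys h. Poly_Mapping.single u (Poly_Mapping.lookup h u)) *
      (\<Sum>q\<in>Poly_Mapping.keys g. Poly_Mapping.single q (Poly_Mapping.lookup g q))"
    by (simp only: expand[symmetric])
  then have "h * g = (\<Sum>u\<in>Poly_Mapping.keys h. \<Sum>q\<in>Poly_Mapping.keys g.
      Poly_Mapping.single (u + q) (Poly_Mapping.lookup h u * Poly_Mapping.lookup g q))"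
    by (simp only: sum_product mult_single)
  then have "(\<Sum>m\<in>C. Poly_Mapping.lookup (h * g) m) = (\<Sum>m\<in>C. \<Sum>u\<in>Poly_Mapping.keys h.
      \<Sum>q\<in>Poly_Mapping.keys g. if u + q = m then Poly_Mapping.lookup h u * Poly_Mapping.lookup g q else 0)"
    by (simp add: lookup_sum lookup_single when_def)
  also have "\<dots> = (\<Sum>u\<in>Poly_Mapping.keys h. \<Sum>q\<in>Poly_Mapping.keys g. \<Sum>m\<in>C.
      if u + q = m then Poly_Mapping.lookup h u * Poly_Mapping.lookup g q else 0)"
    by (rule trans[OF sum.swap], rule sum.cong[OF refl], rule sum.swap)
  also have "\<dots> = (\<Sum>u\<in>Poly_Mapping.keys h. \<Sum>q\<in>Poly_Mapping.keys g.
      if u + q \<in> C then Poly_Mapping.lookup h u * Poly_Mapping.lookup g q else 0)"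
    using assms by simp
  also have "\<dots> = (\<Sum>u\<in>Poly_Mapping.keys h. Poly_Mapping.lookup h u *
      (\<Sum>q | q \<in> Poly_Mapping.keys g \<and> u + q \<in> C. Poly_Mapping.lookup g q))"
    by (auto simp: sum_distrib_left sum.inter_filter intro!: sum.cong)
  finally show ?thesis .
qed

text \<open>
  A quadratic move replaces two factors \<open>Q\<close> of a monomial by two variables \<open>Q'\<close> with the same toric
  exponent. The first component of the exponent is the degree, so \<open>Q'\<close> has size two as well.
\<close>

definition closed_under_quadratic_moves :: "rvec set \<Rightarrow> rvec multiset set \<Rightarrow> bool" where
  "closed_under_quadratic_moves A C \<longleftrightarrow>
     (\<forall>U Q Q'. U + Q \<in> C \<and> size Q = 2 \<and> set_mset Q' \<subseteq> A \<and> toric_exponent Q' = toric_exponent Q \<longrightarrow> U + Q' \<in> C)"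

text \<open>
  For a fixed monomial \<open>u\<close>, the quadratic monomials \<open>q\<close> with \<open>u + q\<close> in \<open>C\<close> form a union of fibres,
  because \<open>C\<close> is closed under quadratic moves. The coefficients of a quadric \<open>g\<close> in the toric ideal
  have sum zero over each of these fibres, so the sum of the coefficients over \<open>C\<close> kills \<open>u g\<close>.
\<close>

lemma sum_coefficients_quadric_multiple:
  fixes g h :: "(rvec, 'k::comm_ring_1) mpoly"
  assumes C: "finite C" "closed_under_quadratic_moves A C"
    and g: "g \<in> poly_ring A" "homogeneous 2 g" "subst_hom t_z g = 0"
  shows "(\<Sum>m\<in>monomial ` C. Poly_Mapping.lookup (h * g) m) = 0"
proof -
  define S where "S = monomial -` Poly_Mapping.keys g"
  have "inj monomial" by (simp add: inj_on_def monomial_eq_iff)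
  moreover have "range monomial = UNIV" by (metis UNIV_eq_I rangeI monomial_cases)
  ultimately have S: "finite S" "Poly_Mapping.keys g \<subseteq> monomial ` S"
    unfolding S_def by (auto intro: finite_vimageI simp: surj_image_vimage_eq)
  have "(\<Sum>q | q \<in> Poly_Mapping.keys g \<and> u + q \<in> monomial ` C. Poly_Mapping.lookup g q) = 0" for u
  proof -
    obtain U where U: "u = monomial U" by (rule monomial_cases)
    define T where "T = {Q \<in> S. U + Q \<in> C}"
    have T: "finite T" using S by (simp add: T_def)
    have "{q. q \<in> Poly_Mapping.keys g \<and> u + q \<in> monomial ` C} = monomial ` T"
      using S(2) by (auto simp: T_def S_def U monomial_eq_iff simp flip: monomial_union)
    then have "(\<Sum>q | q \<in> Poly_Mapping.keys g \<and> u + q \<in> monomial ` C. Poly_Mapping.lookup g q) =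
        (\<Sum>Q\<in>T. Poly_Mapping.lookup g (monomial Q))"
      by (auto intro!: sum.reindex_cong[of monomial] simp: inj_on_def monomial_eq_iff)
    also have "\<dots> = (\<Sum>e\<in>toric_exponent ` T. \<Sum>Q | Q \<in> T \<and> toric_exponent Q = e. Poly_Mapping.lookup g (monomial Q))"
      by (rule sum.image_gen[OF T])
    also have "\<dots> = 0"
    proof (rule sum.neutral, rule ballI)
      fix e assume "e \<in> toric_exponent ` T"
      then obtain Q where Q: "Q \<in> T" "e = toric_exponent Q" by auto
      then have "size Q = 2"
        using g(2) by (auto simp: homogeneous_def T_def S_def size_multiset_overloaded_eq)
      then have "Q' \<in> T" if "Q' \<in> S" "toric_exponent Q' = e" for Q'
        using C(2) g(1) that Q unfolding closed_under_quadratic_moves_def poly_ring_def T_def S_def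
        by fastforce
      then have "{Q'. Q' \<in> T \<and> toric_exponent Q' = e} = {Q'. Q' \<in> S \<and> toric_exponent Q' = e}"
        by (auto simp: T_def)
      then show "(\<Sum>Q' | Q' \<in> T \<and> toric_exponent Q' = e. Poly_Mapping.lookup g (monomial Q')) = 0"
        using lookup_subst_hom[OF S, of e] g(3) by simp
    qed
    finally show ?thesis .
  qed
  then show ?thesis
    using sum_lookup_mult[of "monomial ` C" h g] C(1) by simp
qed

text \<open>
  The sum of the coefficients over \<open>C\<close> is a linear functional that vanishes on the ideal generated by
  the quadrics of the toric ideal, so a single element on which it does not vanish is enough.
\<close>

lemma not_generated_by_quadrics:
  fixes p :: "(rvec, 'k::comm_ring_1) mpoly"
  assumes C: "finite C" "closed_under_quadratic_moves (lattice_points P) C"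
    and p: "p \<in> toric_ideal P" "(\<Sum>m\<in>monomial ` C. Poly_Mapping.lookup p m) \<noteq> 0"
  shows "\<not> generated_by_quadrics (lattice_points P) (toric_ideal P :: (rvec, 'k) mpoly set)"
proof
  let ?A = "lattice_points P"
  assume "generated_by_quadrics ?A (toric_ideal P :: (rvec, 'k) mpoly set)"
  then obtain G :: "(rvec, 'k) mpoly set" where G: "G \<subseteq> {p \<in> poly_ring ?A. homogeneous 2 p}"
    and I: "ideal_generated ?A G = toric_ideal P"
    unfolding generated_by_quadrics_def by blast
  have sub: "subst_hom t_z g = 0" if "g \<in> G" for g
  proof -
    have "g = (\<Sum>g\<in>{g}. 1 * g)" by simp
    moreover have "1 \<in> poly_ring ?A" by (simp add: poly_ring_def)
    ultimately have "g \<in> ideal_generated ?A G"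
      unfolding ideal_generated_def using that by (auto intro!: exI[of _ "{g}"] exI[of _ "\<lambda>_. 1"])
    then show ?thesis using I by (simp add: toric_ideal_def)
  qed
  obtain F h where F: "finite F" "F \<subseteq> G" "p = (\<Sum>g\<in>F. h g * g)"
    using p(1) unfolding I[symmetric] ideal_generated_def by auto
  have "(\<Sum>m\<in>monomial ` C. Poly_Mapping.lookup p m) = (\<Sum>g\<in>F. \<Sum>m\<in>monomial ` C. Poly_Mapping.lookup (h g * g) m)"
    by (simp add: F(3) lookup_sum) (rule sum.swap)
  also have "\<dots> = 0"
    using F(2) G sub by (intro sum.neutral ballI sum_coefficients_quadric_multiple[OF C]) auto
  finally show False using p(2) by simp
qed

section \<open>The configuration and its certificates\<close>

fun dot :: "int list \<Rightarrow> int list \<Rightarrow> int" where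
  "dot (x # xs) (y # ys) = x * y + dot xs ys"
| "dot _ _ = 0"

definition verts :: "int list list" where
  "verts = [[0,0,0,0,0], [1,0,0,0,0], [0,1,0,0,0], [1,1,0,0,0], [0,0,1,0,0], [1,0,1,0,0], [0,0,0,1,0], [1,1,0,1,0], [1,0,1,1,0], [0,0,0,0,1], [1,1,0,0,1], [1,0,1,0,1], [1,1,1,1,1]]"

text \<open>
  A binary space partition. At \<open>Split f s t\<close> the tree \<open>s\<close> takes care of the points with \<open>f \<ge> 0\<close> and
  \<open>t\<close> of those with \<open>f \<le> 0\<close>. A leaf lists the vertices of a simplex other than the origin, each
  with its form in the dual basis, that is, its barycentric coordinate in the simplex.
\<close>

datatype fan_tree = Cone "(int list \<times> int list) list" | Split "int list" fan_tree fan_tree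

fun cones_of :: "fan_tree \<Rightarrow> (int list \<times> int list) list list" where
  "cones_of (Cone c) = [c]"
| "cones_of (Split f s t) = cones_of s @ cones_of t"

text \<open>
  The list \<open>p\<close> contains the forms known to be nonnegative on the path from the root. At a leaf all the
  barycentric coordinates must be nonnegative for an immediate reason: they occur on the path, or they
  are nonnegative on the whole polytope.
\<close>

fun tree_certified :: "int list list \<Rightarrow> fan_tree \<Rightarrow> bool" where
  "tree_certified p (Cone c) \<longleftrightarrow> (\<forall>(v, w)\<in>set c. w \<in> set p \<or> length w = 5 \<and> (\<forall>a\<in>set verts. 0 \<le> dot w a))"
| "tree_certified p (Split f s t) \<longleftrightarrow> tree_certified (f # p) s \<and> tree_certified (map uminus f # p) t"

text \<open>
  One tree for each coordinate \<open>i\<close>, covering the region in which the \<open>i\<close>-th coordinate is minimal;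
  the initial path consists of the four differences with the \<open>i\<close>-th coordinate. In each region the
  vertices other than \<open>(1,1,1,1,1)\<close> have \<open>i\<close>-th coordinate 0, so the coordinate of \<open>(1,1,1,1,1)\<close>
  in the simplex is the \<open>i\<close>-th coordinate function. The other four dual forms have coefficient sum 0;
  they describe the cone modulo the line through \<open>(1,1,1,1,1)\<close>, and all of them occur on the path.
\<close>

definition orthants :: "(int list list \<times> fan_tree) list" where
  "orthants = [
  ([[-1,1,0,0,0], [-1,0,1,0,0], [-1,0,0,1,0], [-1,0,0,0,1]],
   Cone [([0,1,0,0,0], [-1,1,0,0,0]), ([0,0,1,0,0], [-1,0,1,0,0]), ([0,0,0,1,0], [-1,0,0,1,0]), ([0,0,0,0,1], [-1,0,0,0,1]), ([1,1,1,1,1], [1,0,0,0,0])]),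
  ([[1,-1,0,0,0], [0,-1,1,0,0], [0,-1,0,1,0], [0,-1,0,0,1]],
   Split [1,0,-1,0,0]
    (Split [0,0,1,-1,0]
      (Split [0,1,1,-1,-1]
        (Cone [([1,0,0,0,0], [1,0,-1,0,0]), ([1,0,1,0,0], [0,1,1,-1,-1]), ([1,0,1,1,0], [0,-1,0,1,0]), ([1,0,1,0,1], [0,-1,0,0,1]), ([1,1,1,1,1], [0,1,0,0,0])])
        (Cone [([1,0,0,0,0], [1,0,-1,0,0]), ([1,0,1,1,0], [0,-1,0,1,0]), ([0,0,0,0,1], [0,-1,-1,1,1]), ([1,0,1,0,1], [0,0,1,-1,0]), ([1,1,1,1,1], [0,1,0,0,0])]))
      (Cone [([1,0,0,0,0], [1,0,-1,0,0]), ([0,0,0,1,0], [0,0,-1,1,0]), ([1,0,1,1,0], [0,-1,1,0,0]), ([0,0,0,0,1], [0,-1,0,0,1]), ([1,1,1,1,1], [0,1,0,0,0])]))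
    (Split [1,0,0,-1,0]
      (Split [1,1,0,-1,-1]
        (Cone [([0,0,1,0,0], [-1,0,1,0,0]), ([1,0,1,0,0], [1,1,0,-1,-1]), ([1,0,1,1,0], [0,-1,0,1,0]), ([1,0,1,0,1], [0,-1,0,0,1]), ([1,1,1,1,1], [0,1,0,0,0])])
        (Cone [([0,0,1,0,0], [-1,0,1,0,0]), ([1,0,1,1,0], [0,-1,0,1,0]), ([0,0,0,0,1], [-1,-1,0,1,1]), ([1,0,1,0,1], [1,0,0,-1,0]), ([1,1,1,1,1], [0,1,0,0,0])]))
      (Cone [([0,0,1,0,0], [-1,0,1,0,0]), ([0,0,0,1,0], [-1,0,0,1,0]), ([1,0,1,1,0], [1,-1,0,0,0]), ([0,0,0,0,1], [0,-1,0,0,1]), ([1,1,1,1,1], [0,1,0,0,0])]))),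
  ([[1,0,-1,0,0], [0,1,-1,0,0], [0,0,-1,1,0], [0,0,-1,0,1]],
   Split [1,-1,0,0,0]
    (Split [0,1,0,0,-1]
      (Split [0,1,1,-1,-1]
        (Cone [([1,0,0,0,0], [1,-1,0,0,0]), ([1,1,0,0,0], [0,1,1,-1,-1]), ([1,1,0,1,0], [0,0,-1,1,0]), ([1,1,0,0,1], [0,0,-1,0,1]), ([1,1,1,1,1], [0,0,1,0,0])])
        (Cone [([1,0,0,0,0], [1,-1,0,0,0]), ([0,0,0,1,0], [0,-1,-1,1,1]), ([1,1,0,1,0], [0,1,0,0,-1]), ([1,1,0,0,1], [0,0,-1,0,1]), ([1,1,1,1,1], [0,0,1,0,0])]))
      (Cone [([1,0,0,0,0], [1,-1,0,0,0]), ([0,0,0,1,0], [0,0,-1,1,0]), ([0,0,0,0,1], [0,-1,0,0,1]), ([1,1,0,0,1], [0,1,-1,0,0]), ([1,1,1,1,1], [0,0,1,0,0])]))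
    (Split [1,0,0,0,-1]
      (Split [1,0,1,-1,-1]
        (Cone [([0,1,0,0,0], [-1,1,0,0,0]), ([1,1,0,0,0], [1,0,1,-1,-1]), ([1,1,0,1,0], [0,0,-1,1,0]), ([1,1,0,0,1], [0,0,-1,0,1]), ([1,1,1,1,1], [0,0,1,0,0])])
        (Cone [([0,1,0,0,0], [-1,1,0,0,0]), ([0,0,0,1,0], [-1,0,-1,1,1]), ([1,1,0,1,0], [1,0,0,0,-1]), ([1,1,0,0,1], [0,0,-1,0,1]), ([1,1,1,1,1], [0,0,1,0,0])]))
      (Cone [([0,1,0,0,0], [-1,1,0,0,0]), ([0,0,0,1,0], [0,0,-1,1,0]), ([0,0,0,0,1], [-1,0,0,0,1]), ([1,1,0,0,1], [1,0,-1,0,0]), ([1,1,1,1,1], [0,0,1,0,0])]))),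
  ([[1,0,0,-1,0], [0,1,0,-1,0], [0,0,1,-1,0], [0,0,0,-1,1]],
   Split [1,-1,-1,1,0]
    (Split [0,0,1,0,-1]
      (Cone [([1,0,0,0,0], [1,-1,-1,1,0]), ([1,1,0,0,0], [0,1,0,-1,0]), ([1,0,1,0,0], [0,0,1,0,-1]), ([1,0,1,0,1], [0,0,0,-1,1]), ([1,1,1,1,1], [0,0,0,1,0])])
      (Split [0,1,1,-1,-1]
        (Cone [([1,0,0,0,0], [1,-1,-1,1,0]), ([1,1,0,0,0], [0,1,1,-1,-1]), ([1,1,0,0,1], [0,0,-1,0,1]), ([1,0,1,0,1], [0,0,1,-1,0]), ([1,1,1,1,1], [0,0,0,1,0])])
        (Cone [([1,0,0,0,0], [1,-1,-1,1,0]), ([0,0,0,0,1], [0,-1,-1,1,1]), ([1,1,0,0,1], [0,1,0,-1,0]), ([1,0,1,0,1], [0,0,1,-1,0]), ([1,1,1,1,1], [0,0,0,1,0])])))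
    (Split [1,0,0,0,-1]
      (Split [0,0,1,0,-1]
        (Split [1,-1,0,1,-1]
          (Cone [([1,1,0,0,0], [0,1,0,-1,0]), ([0,0,1,0,0], [-1,1,1,-1,0]), ([1,0,1,0,0], [1,-1,0,1,-1]), ([1,0,1,0,1], [0,0,0,-1,1]), ([1,1,1,1,1], [0,0,0,1,0])])
          (Cone [([0,1,0,0,0], [-1,1,0,-1,1]), ([1,1,0,0,0], [1,0,0,0,-1]), ([0,0,1,0,0], [0,0,1,0,-1]), ([1,0,1,0,1], [0,0,0,-1,1]), ([1,1,1,1,1], [0,0,0,1,0])]))
        (Cone [([0,1,0,0,0], [-1,1,1,-1,0]), ([1,1,0,0,0], [1,0,0,0,-1]), ([1,1,0,0,1], [0,0,-1,0,1]), ([1,0,1,0,1], [0,0,1,-1,0]), ([1,1,1,1,1], [0,0,0,1,0])]))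
      (Split [1,0,-1,0,0]
        (Cone [([0,1,0,0,0], [-1,1,1,-1,0]), ([0,0,0,0,1], [-1,0,0,0,1]), ([1,1,0,0,1], [1,0,-1,0,0]), ([1,0,1,0,1], [0,0,1,-1,0]), ([1,1,1,1,1], [0,0,0,1,0])])
        (Cone [([0,1,0,0,0], [0,1,0,-1,0]), ([0,0,1,0,0], [-1,0,1,0,0]), ([0,0,0,0,1], [-1,0,0,0,1]), ([1,0,1,0,1], [1,0,0,-1,0]), ([1,1,1,1,1], [0,0,0,1,0])])))),
  ([[1,0,0,0,-1], [0,1,0,0,-1], [0,0,1,0,-1], [0,0,0,1,-1]],
   Split [1,-1,-1,0,1]
    (Split [0,1,0,-1,0]
      (Cone [([1,0,0,0,0], [1,-1,-1,0,1]), ([1,1,0,0,0], [0,1,0,-1,0]), ([1,0,1,0,0], [0,0,1,0,-1]), ([1,1,0,1,0], [0,0,0,1,-1]), ([1,1,1,1,1], [0,0,0,0,1])])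
      (Split [0,1,1,-1,-1]
        (Cone [([1,0,0,0,0], [1,-1,-1,0,1]), ([1,0,1,0,0], [0,1,1,-1,-1]), ([1,1,0,1,0], [0,1,0,0,-1]), ([1,0,1,1,0], [0,-1,0,1,0]), ([1,1,1,1,1], [0,0,0,0,1])])
        (Cone [([1,0,0,0,0], [1,-1,-1,0,1]), ([0,0,0,1,0], [0,-1,-1,1,1]), ([1,1,0,1,0], [0,1,0,0,-1]), ([1,0,1,1,0], [0,0,1,0,-1]), ([1,1,1,1,1], [0,0,0,0,1])])))
    (Split [1,-1,0,0,0]
      (Split [0,1,0,-1,0]
        (Cone [([1,1,0,0,0], [0,1,0,-1,0]), ([0,0,1,0,0], [-1,1,1,0,-1]), ([1,0,1,0,0], [1,-1,0,0,0]), ([1,1,0,1,0], [0,0,0,1,-1]), ([1,1,1,1,1], [0,0,0,0,1])])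
        (Split [1,0,0,-1,0]
          (Cone [([0,0,1,0,0], [-1,1,1,0,-1]), ([1,0,1,0,0], [1,0,0,-1,0]), ([1,1,0,1,0], [0,1,0,0,-1]), ([1,0,1,1,0], [0,-1,0,1,0]), ([1,1,1,1,1], [0,0,0,0,1])])
          (Cone [([0,0,1,0,0], [-1,1,1,0,-1]), ([0,0,0,1,0], [-1,0,0,1,0]), ([1,1,0,1,0], [0,1,0,0,-1]), ([1,0,1,1,0], [1,-1,0,0,0]), ([1,1,1,1,1], [0,0,0,0,1])])))
      (Split [1,0,0,-1,0]
        (Cone [([0,1,0,0,0], [-1,1,0,0,0]), ([1,1,0,0,0], [1,0,0,-1,0]), ([0,0,1,0,0], [0,0,1,0,-1]), ([1,1,0,1,0], [0,0,0,1,-1]), ([1,1,1,1,1], [0,0,0,0,1])])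
        (Cone [([0,1,0,0,0], [-1,1,0,0,0]), ([0,0,1,0,0], [0,0,1,0,-1]), ([0,0,0,1,0], [-1,0,0,1,0]), ([1,1,0,1,0], [1,0,0,0,-1]), ([1,1,1,1,1], [0,0,0,0,1])]))))]"

definition cones :: "(int list \<times> int list) list list" where
  "cones = concat (map (\<lambda>(p, t). cones_of t) orthants)"

text \<open>
  Each pair of the 29 cones is separated by one of these forms. They have coefficient sum 0, since
  every simplex contains \<open>(1,1,1,1,1)\<close>.
\<close>

definition separators :: "int list list" where
  "separators = [
[1,0,0,-1,0],
[1,-1,0,0,0],
[1,0,0,0,-1],
[0,0,1,0,-1],
[1,0,-1,0,0],
[0,1,1,-1,-1],
[0,1,-1,0,0],
[1,-1,-1,1,0],
[0,0,1,-1,0],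
[0,1,0,-1,0],
[1,-1,-1,0,1],
[0,0,0,1,-1],
[0,1,0,0,-1],
[1,0,1,-1,-1],
[1,1,0,-1,-1],
[1,-1,0,1,-1],
[0,1,2,-2,-1],
[0,2,1,-1,-2],
[0,0,1,1,-2],
[1,-2,0,0,1],
[1,0,-2,1,0],
[1,0,1,0,-2],
[1,1,0,-2,0],
[0,1,-2,1,0],
[0,1,1,-2,0],
[0,1,1,0,-2],
[1,0,-1,-1,1],
[1,-2,-1,1,1],
[1,-1,-2,1,1]]"

lemma orthants_certified: "\<forall>(p, t)\<in>set orthants. tree_certified p t"
  by code_simp

text \<open>
  The vertices and the forms are dual to each other in both orders of multiplication; the second order
  spares an argument about dimensions. The last condition says that the barycentric coordinate of the
  origin is nonnegative on the whole polytope, that is, that the facet opposite to the origin lies on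
  the boundary of the polytope.
\<close>

definition unimodular_cone :: "(int list \<times> int list) list \<Rightarrow> bool" where
  "unimodular_cone c \<longleftrightarrow> length c = 5 \<and>
     (\<forall>(v, w)\<in>set c. v \<in> set verts \<and> length w = 5) \<and>
     (\<forall>i\<in>{..<5}. \<forall>j\<in>{..<5}. dot (snd (c ! i)) (fst (c ! j)) = (if i = j then 1 else 0)) \<and>
     (\<forall>k\<in>{..<5}. \<forall>l\<in>{..<5}. (\<Sum>(v, w)\<leftarrow>c. w ! k * v ! l) = (if k = l then 1 else 0)) \<and>
     (\<forall>a\<in>set verts. (\<Sum>(v, w)\<leftarrow>c. dot w a) \<le> 1)"

lemma unimodular_cones: "\<forall>c\<in>set cones. unimodular_cone c"
  by code_simp

text \<open>
  The weak separation of two cones by a hyperplane leaves room for an intersection inside the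
  hyperplane. The last condition makes one of the two faces that lie there a common face.
\<close>

definition separates :: "int list \<Rightarrow> (int list \<times> int list) list \<Rightarrow> (int list \<times> int list) list \<Rightarrow> bool" where
  "separates f c d \<longleftrightarrow>
     (\<forall>v\<in>fst ` set c. 0 \<le> dot f v) \<and> (\<forall>v\<in>fst ` set d. dot f v \<le> 0) \<and>
     ((\<forall>v\<in>fst ` set c. dot f v = 0 \<longrightarrow> v \<in> fst ` set d) \<or>
      (\<forall>v\<in>fst ` set d. dot f v = 0 \<longrightarrow> v \<in> fst ` set c))"

lemma cones_separated:
  "sorted_wrt (\<lambda>c d. \<exists>f\<in>set separators. separates f c d \<or> separates f d c) cones"
  by code_simp

text \<open>
  These are the pairs of vertices that the triangulation does not join, hence the generators of its
  Stanley-Reisner ideal.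
\<close>

definition nonedges :: "(int list \<times> int list) list" where
  "nonedges = [([1,0,0,0,0], [0,1,0,0,0]),
     ([1,0,0,0,0], [0,0,1,0,0]),
     ([0,1,0,0,0], [1,0,1,0,0]),
     ([0,1,0,0,0], [1,0,1,1,0]),
     ([1,1,0,0,0], [0,0,0,1,0]),
     ([1,1,0,0,0], [1,0,1,1,0]),
     ([1,1,0,0,0], [0,0,0,0,1]),
     ([0,0,1,0,0], [1,1,0,0,1]),
     ([1,0,1,0,0], [0,0,0,1,0]),
     ([1,0,1,0,0], [0,0,0,0,1]),
     ([1,0,1,0,0], [1,1,0,0,1]),
     ([0,0,0,1,0], [1,0,1,0,1]),
     ([1,1,0,1,0], [0,0,0,0,1]),
     ([1,1,0,1,0], [1,0,1,0,1]),
     ([1,0,1,1,0], [1,1,0,0,1])]"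

lemma nonedges_not_in_cones:
  "\<forall>(u, v)\<in>set nonedges. \<forall>c\<in>set cones. \<not> (u \<in> fst ` set c \<and> v \<in> fst ` set c)"
  by code_simp

text \<open>
  A clique either avoids the first vertex \<open>v\<close>, or it contains \<open>v\<close> and otherwise only neighbours of
  \<open>v\<close>; in the second case the candidates for a face containing the clique are those that contain \<open>v\<close>.
\<close>

fun cliques_covered :: "int list list \<Rightarrow> int list list list \<Rightarrow> bool" where
  "cliques_covered [] Fs \<longleftrightarrow> Fs \<noteq> []"
| "cliques_covered (v # vs) Fs \<longleftrightarrow> cliques_covered vs Fs \<and>
     cliques_covered (filter (\<lambda>u. (u, v) \<notin> set nonedges \<and> (v, u) \<notin> set nonedges) vs)
       (filter (\<lambda>F. v \<in> set F) Fs)"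

text \<open>
  The origin, at the head of \<open>verts\<close>, belongs to all the simplices and is left out of the enumeration.
\<close>

lemma cliques_covered_cones: "cliques_covered (tl verts) (map (map fst) cones)"
  by code_simp

text \<open>
  The four triples in the order in which the rewriting of non-edges visits them.
\<close>

definition cycle_triples :: "int list list list" where
  "cycle_triples =
    [[[0,1,0,0,0], [0,0,0,1,0], [1,0,1,0,1]],
     [[0,1,0,0,0], [0,0,0,0,1], [1,0,1,1,0]],
     [[0,0,1,0,0], [0,0,0,0,1], [1,1,0,1,0]],
     [[0,0,1,0,0], [0,0,0,1,0], [1,1,0,0,1]]]"

lemma cycle_triples_closed:
  "\<forall>t\<in>set cycle_triples. \<forall>a\<in>set t. \<forall>b\<in>set verts. \<forall>c\<in>set verts.
     map2 (+) b c = map2 (+) (remove1 a t ! 0) (remove1 a t ! 1) \<longrightarrow>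
     (\<exists>s\<in>set cycle_triples. a \<in> set s \<and> b \<in> set (remove1 a s) \<and> remove1 b (remove1 a s) = [c])"
  by code_simp

section \<open>The triangulation\<close>

definition pt :: "int list \<Rightarrow> rvec" where
  "pt v = Poly_Mapping.nth (map of_int v)"

lemma lookup_pt: "Poly_Mapping.lookup (pt v) i = (if i < length v then of_int (v ! i) else 0)"
  by (simp add: pt_def nth_default_def)

definition lin :: "int list \<Rightarrow> rvec \<Rightarrow> real" where
  "lin w x = (\<Sum>i<length w. of_int (w ! i) * Poly_Mapping.lookup x i)"

lemma linear_lin: "linear (lin w)"
  by (rule linearI) (simp_all add: lin_def lookup_add algebra_simps sum.distrib sum_distrib_left)

lemma lin_uminus: "lin (map uminus w) x = - lin w x"
  by (simp add: lin_def sum_negf)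

lemma dot_eq_sum: "length v = length w \<Longrightarrow> dot w v = (\<Sum>i<length w. w ! i * v ! i)"
  by (induction v w rule: list_induct2) (simp_all add: sum.lessThan_Suc_shift del: sum.lessThan_Suc)

lemma lin_pt: "length v = length w \<Longrightarrow> lin w (pt v) = of_int (dot w v)"
  by (simp add: dot_eq_sum lin_def lookup_pt)

lemma pt_inj: "length u = length v \<Longrightarrow> pt u = pt v \<longleftrightarrow> u = v"
proof
  assume len: "length u = length v" and eq: "pt u = pt v"
  show "u = v"
  proof (rule nth_equalityI[OF len])
    fix i assume "i < length u"
    then have "real_of_int (u ! i) = of_int (v ! i)"
      using arg_cong[OF eq, of "\<lambda>x. Poly_Mapping.lookup x i"] len by (simp add: lookup_pt)
    then show "u ! i = v ! i" by simp
  qed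
qed simp

lemma verts_01: "\<forall>v\<in>set verts. length v = 5 \<and> set v \<subseteq> {0, 1}"
  by (simp add: verts_def)

lemma length_verts: "v \<in> set verts \<Longrightarrow> length v = 5"
  using verts_01 by blast

lemma pt_zero: "pt [0, 0, 0, 0, 0] = 0"
  by (rule poly_mapping_eqI) (auto simp: lookup_pt nth_Cons split: nat.splits)

definition config :: "rvec set" where "config = pt ` set verts"

definition config_polytope :: "rvec set" where "config_polytope = convex hull config"

lemma config_zero_one: "config \<subseteq> zero_one_points 5"
proof
  fix a assume "a \<in> config"
  then obtain v where v: "v \<in> set verts" "a = pt v" by (auto simp: config_def)
  then have "v ! i = 0 \<or> v ! i = 1" if "i < 5" for i
    using verts_01 that nth_mem[of i v] by fastforce
  then show "a \<in> zero_one_points 5"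
    using length_verts[OF v(1)] v(2)
    by (auto simp: zero_one_points_def Rvecs_def in_keys_iff lookup_pt split: if_splits)
qed

lemma finite_config: "finite config" by (simp add: config_def)

text \<open>
  A lattice point of the cube is a vertex of the cube, so a convex combination of \<open>(0,1)\<close>-points that
  gives this point cannot involve any other point with positive weight.
\<close>

lemma lattice_points_convex_hull_01:
  assumes "finite S" "S \<subseteq> zero_one_points d"
  shows "lattice_points (convex hull S) = S"
proof
  have 01: "Poly_Mapping.lookup a i = 0 \<or> Poly_Mapping.lookup a i = 1" if "a \<in> S" for a i
    using assms(2) that by (auto simp: zero_one_points_def)
  have "v \<in> S" if v: "v \<in> convex hull S" "\<forall>i. Poly_Mapping.lookup v i \<in> \<int>" for v
  proof -
    obtain u where u: "\<forall>a\<in>S. 0 \<le> u a" "sum u S = 1" "(\<Sum>a\<in>S. u a *\<^sub>R a) = v"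
      using v(1) unfolding convex_hull_finite[OF assms(1)] by auto
    then obtain a where a: "a \<in> S" "u a \<noteq> 0" by (metis sum.neutral zero_neq_one)
    then have ua: "0 < u a" using u(1) by force
    have v_eq: "Poly_Mapping.lookup v i = (\<Sum>b\<in>S. u b * Poly_Mapping.lookup b i)" for i
      by (simp add: lookup_sum flip: u(3))
    have "Poly_Mapping.lookup v i = Poly_Mapping.lookup a i" for i
    proof -
      have nonneg: "0 \<le> u b * Poly_Mapping.lookup b i"
        and nonneg': "0 \<le> u b * (1 - Poly_Mapping.lookup b i)" if "b \<in> S - {a}" for b
        using that u(1) 01[of b i] by auto
      have ge: "u a * Poly_Mapping.lookup a i \<le> Poly_Mapping.lookup v i"
        unfolding v_eq by (rule member_le_sum[OF a(1) nonneg assms(1)]) auto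
      have "u a * (1 - Poly_Mapping.lookup a i) \<le> (\<Sum>b\<in>S. u b * (1 - Poly_Mapping.lookup b i))"
        by (rule member_le_sum[OF a(1) nonneg' assms(1)]) auto
      also have "\<dots> = 1 - Poly_Mapping.lookup v i"
        by (simp add: v_eq right_diff_distrib sum_subtractf u(2))
      finally have le: "u a * (1 - Poly_Mapping.lookup a i) \<le> 1 - Poly_Mapping.lookup v i" .
      obtain z where z: "Poly_Mapping.lookup v i = of_int z" using v(2) by (auto elim: Ints_cases)
      from 01[OF a(1), of i] show ?thesis
      proof
        assume *: "Poly_Mapping.lookup a i = 0"
        then have "0 \<le> z" "z < 1" using ge le ua z by auto
        then show ?thesis using z * by auto
      next
        assume *: "Poly_Mapping.lookup a i = 1"
        then have "0 < z" "z \<le> 1" using ge le ua z by auto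
        then show ?thesis using z * by auto
      qed
    qed
    then show "v \<in> S" using a(1) poly_mapping_eqI[of v a] by simp
  qed
  then show "lattice_points (convex hull S) \<subseteq> S" by (auto simp: lattice_points_def)
  show "S \<subseteq> lattice_points (convex hull S)"
  proof
    fix a assume a: "a \<in> S"
    have "Poly_Mapping.lookup a i \<in> \<int>" for i using 01[OF a, of i] by auto
    then show "a \<in> lattice_points (convex hull S)" using a by (simp add: lattice_points_def hull_inc)
  qed
qed

lemma lattice_points_config_polytope: "lattice_points config_polytope = config"
  unfolding config_polytope_def using finite_config config_zero_one by (rule lattice_points_convex_hull_01)

lemma config_polytope_Rvecs: "config_polytope \<subseteq> Rvecs 5"
proof -
  have "convex (Rvecs 5)"
  proof -
    have "Rvecs 5 = {v. \<forall>i\<ge>5. Poly_Mapping.lookup v i = 0}"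
      by (auto simp: Rvecs_def subset_iff in_keys_iff) (metis not_le)
    then show ?thesis by (auto simp: convex_def lookup_add)
  qed
  then show ?thesis
    unfolding config_polytope_def using config_zero_one by (intro hull_minimal) (auto simp: zero_one_points_def)
qed

text \<open>
  The origin is a vertex of every maximal simplex, which makes the other barycentric coordinates linear.
\<close>

definition simplex_of :: "(int list \<times> int list) list \<Rightarrow> rvec set" where
  "simplex_of c = insert 0 (pt ` fst ` set c)"

context
  fixes c assumes c: "c \<in> set cones"
begin

lemma length_cone: "length c = 5"
  using c unimodular_cones by (auto simp: unimodular_cone_def)

lemma cone_entry: "(v, w) \<in> set c \<Longrightarrow> v \<in> set verts \<and> length v = 5 \<and> length w = 5"
  using c unimodular_cones length_verts unfolding unimodular_cone_def by blast

lemma nth_cone: "i < 5 \<Longrightarrow> fst (c ! i) \<in> set verts \<and> length (fst (c ! i)) = 5 \<and> length (snd (c ! i)) = 5"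
  using cone_entry[of "fst (c ! i)" "snd (c ! i)"] length_cone by simp

lemma lin_dual: "i < 5 \<Longrightarrow> j < 5 \<Longrightarrow> lin (snd (c ! i)) (pt (fst (c ! j))) = (if i = j then 1 else 0)"
  using c unimodular_cones nth_cone by (simp add: lin_pt unimodular_cone_def)

lemma set_cone: "set c = (\<lambda>i. c ! i) ` {..<5}"
  using length_cone by (auto simp: set_conv_nth)

lemma simplex_of_nth: "simplex_of c = insert 0 ((\<lambda>i. pt (fst (c ! i))) ` {..<5})"
  by (simp add: simplex_of_def set_cone image_image)

lemma finite_simplex: "finite (simplex_of c)" by (simp add: simplex_of_def)

lemma simplex_subset_config: "simplex_of c \<subseteq> config"
proof -
  have "0 \<in> config" using pt_zero by (force simp: config_def verts_def)
  then show ?thesis using cone_entry by (auto simp: simplex_of_def config_def)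
qed

lemma dual_expansion:
  assumes "x \<in> Rvecs 5"
  shows "x = (\<Sum>i<5. lin (snd (c ! i)) x *\<^sub>R pt (fst (c ! i)))"
proof (rule poly_mapping_eqI)
  fix k
  show "Poly_Mapping.lookup x k =
      Poly_Mapping.lookup (\<Sum>i<5. lin (snd (c ! i)) x *\<^sub>R pt (fst (c ! i))) k"
  proof (cases "k < 5")
    case True
    have "(\<Sum>i<5. snd (c ! i) ! m * fst (c ! i) ! k) = (if m = k then 1 else 0)" if "m < 5" for m
    proof -
      have "(\<Sum>(v, w)\<leftarrow>c. w ! m * v ! k) = (if m = k then 1 else 0)"
        using c unimodular_cones that True by (simp add: unimodular_cone_def)
      then show ?thesis
        by (simp add: sum_list_sum_nth length_cone case_prod_unfold atLeast0LessThan)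
    qed
    then have delta: "(\<Sum>i<5. real_of_int (snd (c ! i) ! m) * real_of_int (fst (c ! i) ! k)) = (if m = k then 1 else 0)"
      if "m < 5" for m
      using that by (simp flip: of_int_mult of_int_sum)
    have "Poly_Mapping.lookup (\<Sum>i<5. lin (snd (c ! i)) x *\<^sub>R pt (fst (c ! i))) k =
        (\<Sum>i<5. (\<Sum>m<5. of_int (snd (c ! i) ! m) * Poly_Mapping.lookup x m) * of_int (fst (c ! i) ! k))"
      using True nth_cone by (simp add: lookup_sum lookup_pt lin_def)
    also have "\<dots> = (\<Sum>m<5. \<Sum>i<5. of_int (snd (c ! i) ! m) * Poly_Mapping.lookup x m * of_int (fst (c ! i) ! k))"
      unfolding sum_distrib_right by (rule sum.swap)
    also have "\<dots> = (\<Sum>m<5. Poly_Mapping.lookup x m *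
        (\<Sum>i<5. real_of_int (snd (c ! i) ! m) * real_of_int (fst (c ! i) ! k)))"
      by (simp add: sum_distrib_left mult_ac)
    also have "\<dots> = Poly_Mapping.lookup x k"
      using True by (simp add: delta if_distrib cong: if_cong)
    finally show ?thesis by simp
  next
    case False
    then show ?thesis
      using assms nth_cone by (auto simp: Rvecs_def in_keys_iff lookup_sum lookup_pt)
  qed
qed

lemma simplex_affine_independent: "\<not> affine_dependent (simplex_of c)"
proof
  assume "affine_dependent (simplex_of c)"
  then obtain U where U: "sum U (simplex_of c) = 0" "\<exists>a\<in>simplex_of c. U a \<noteq> 0"
    "(\<Sum>a\<in>simplex_of c. U a *\<^sub>R a) = 0"
    unfolding affine_dependent_explicit_finite[OF finite_simplex] by blast
  have vertex: "U (pt (fst (c ! i))) = 0" if i: "i < 5" for i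
  proof -
    let ?p = "pt (fst (c ! i))"
    have "lin (snd (c ! i)) a = (if a = ?p then 1 else 0)" if a: "a \<in> simplex_of c" for a
    proof -
      consider "a = 0" | j where "j < 5" "a = pt (fst (c ! j))"
        using a by (auto simp: simplex_of_nth)
      then show ?thesis
      proof cases
        case 1
        then show ?thesis using lin_dual[OF i i] linear_0[OF linear_lin] by auto
      next
        case 2
        then show ?thesis using lin_dual[OF i 2(1)] lin_dual[OF i i] by auto
      qed
    qed
    then have "(\<Sum>a\<in>simplex_of c. U a * lin (snd (c ! i)) a) = (\<Sum>a\<in>simplex_of c. if a = ?p then U a else 0)"
      by (intro sum.cong) auto
    then have "lin (snd (c ! i)) (\<Sum>a\<in>simplex_of c. U a *\<^sub>R a) = (\<Sum>a\<in>simplex_of c. if a = ?p then U a else 0)"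
      by (simp add: linear_sum[OF linear_lin] linear_scale[OF linear_lin])
    also have "\<dots> = U ?p"
      using i by (simp add: finite_simplex simplex_of_nth)
    finally show ?thesis using U(3) linear_0[OF linear_lin] by simp
  qed
  then have nz: "U a = 0" if "a \<in> simplex_of c - {0}" for a
    using that by (auto simp: simplex_of_nth)
  have "sum U (simplex_of c) = U 0 + sum U (simplex_of c - {0})"
    by (rule sum.remove[OF finite_simplex]) (simp add: simplex_of_def)
  then have "U 0 = 0" using U(1) nz by simp
  then show False using U(2) nz by blast
qed

text \<open>
  The barycentric coordinate of the origin is what the other coordinates leave of 1.
\<close>

lemma in_simplex:
  assumes "x \<in> Rvecs 5" "\<forall>(v, w)\<in>set c. 0 \<le> lin w x" "(\<Sum>(v, w)\<leftarrow>c. lin w x) \<le> 1"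
  shows "x \<in> convex hull (simplex_of c)"
proof -
  define l where "l i = lin (snd (c ! i)) x" for i
  have l: "0 \<le> l i" if "i < 5" for i
    using assms(2) that length_cone nth_mem[of i c] by (force simp: l_def case_prod_unfold)
  have s: "(\<Sum>i<5. l i) \<le> 1"
    using assms(3) by (simp add: sum_list_sum_nth length_cone case_prod_unfold atLeast0LessThan l_def)
  \<comment> \<open>The index 5 stands for the origin.\<close>
  define m where "m i = (if i < 5 then l i else 1 - (\<Sum>i<5. l i))" for i
  define y where "y i = (if i < 5 then pt (fst (c ! i)) else 0)" for i
  have "(\<Sum>i\<in>{..5::nat}. m i *\<^sub>R y i) \<in> convex hull (simplex_of c)"
  proof (rule convex_sum)
    have "sum m {..5} = sum m (insert 5 {..<5})" by (rule sum.cong) auto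
    then show "sum m {..5} = 1" by (simp add: m_def)
    show "y i \<in> convex hull (simplex_of c)" if "i \<in> {..5}" for i
      using that by (intro hull_inc) (auto simp: y_def simplex_of_nth)
  qed (use l s in \<open>auto simp: m_def\<close>)
  also have "(\<Sum>i\<in>{..5::nat}. m i *\<^sub>R y i) = (\<Sum>i\<in>insert 5 {..<5}. m i *\<^sub>R y i)"
    by (rule sum.cong) auto
  also have "\<dots> = x"
    using dual_expansion[OF assms(1)] by (simp add: m_def y_def l_def)
  finally show ?thesis .
qed

lemma sum_lin_le_1: "x \<in> config_polytope \<Longrightarrow> (\<Sum>(v, w)\<leftarrow>c. lin w x) \<le> 1"
proof -
  assume x: "x \<in> config_polytope"
  let ?f = "\<lambda>x. - (\<Sum>i<5. lin (snd (c ! i)) x)"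
  have f: "?f x = - (\<Sum>(v, w)\<leftarrow>c. lin w x)" for x
    by (simp add: sum_list_sum_nth length_cone case_prod_unfold atLeast0LessThan)
  have lin: "linear ?f"
    by (intro linear_compose_neg linear_compose_sum ballI linear_lin)
  have "-1 \<le> ?f x"
  proof (rule linear_ge_on_convex_hull[OF lin _ x[unfolded config_polytope_def]])
    fix a assume "a \<in> config"
    then obtain v where v: "v \<in> set verts" "a = pt v" by (auto simp: config_def)
    have "(\<Sum>i<5. dot (snd (c ! i)) v) \<le> 1"
      using c unimodular_cones v(1)
      by (force simp: unimodular_cone_def sum_list_sum_nth length_cone case_prod_unfold atLeast0LessThan)
    moreover have "(\<Sum>i<5. lin (snd (c ! i)) a) = of_int (\<Sum>i<5. dot (snd (c ! i)) v)"
      using nth_cone length_verts[OF v(1)] by (simp add: v(2) lin_pt)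
    ultimately show "-1 \<le> ?f a" by linarith
  qed
  then show ?thesis unfolding f by simp
qed

lemma normalized_volume_simplex: "normalized_volume 5 (convex hull (simplex_of c)) = 1"
proof -
  obtain idx :: "5 \<Rightarrow> nat" where idx: "bij_betw idx UNIV {..<5}"
    using ex_bij_betw_finite_nat[of "UNIV :: 5 set"] by (auto simp: atLeast0LessThan)
  then have idx5: "idx i < 5" for i by (auto simp: bij_betw_def)
  have "simplex_of c = insert 0 (range (\<lambda>i. pt (fst (c ! idx i))))"
    unfolding simplex_of_nth bij_betw_imp_surj_on[OF idx, symmetric] image_image ..
  moreover have "normalized_volume 5 (convex hull (insert 0 (range (\<lambda>i. pt (fst (c ! idx i)))))) = 1"
  proof (rule normalized_volume_unimodular_simplex[OF idx])
    show "Poly_Mapping.lookup (pt (fst (c ! idx i))) k \<in> \<int>" for i k by (simp add: lookup_pt)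
    fix i j
    have "(\<Sum>k<5. of_int (snd (c ! idx i) ! k) * Poly_Mapping.lookup (pt (fst (c ! idx j))) k) =
        lin (snd (c ! idx i)) (pt (fst (c ! idx j)))"
      using nth_cone idx5 by (simp add: lin_def)
    also have "\<dots> = (if i = j then 1 else 0)"
      using lin_dual[OF idx5 idx5] idx by (auto simp: bij_betw_def inj_on_def)
    finally show "(\<Sum>k<5. of_int ((\<lambda>i k. snd (c ! idx i) ! k) i k) * Poly_Mapping.lookup (pt (fst (c ! idx j))) k) =
        (if i = j then 1 else 0)" by simp
  qed
  ultimately show ?thesis by simp
qed

end

lemma tree_certified_sound:
  assumes "tree_certified p t" "x \<in> config_polytope" "\<forall>w\<in>set p. 0 \<le> lin w x"
  shows "\<exists>c\<in>set (cones_of t). \<forall>(v, w)\<in>set c. 0 \<le> lin w x"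
  using assms(1,3)
proof (induction t arbitrary: p)
  case (Cone c)
  have "0 \<le> lin w x" if "(v, w) \<in> set c" for v w
  proof (cases "w \<in> set p")
    case True
    then show ?thesis using Cone.prems(2) by blast
  next
    case False
    then have w: "length w = 5" "\<forall>a\<in>set verts. 0 \<le> dot w a" using Cone.prems(1) that by auto
    show ?thesis
    proof (rule linear_ge_on_convex_hull[OF linear_lin _ assms(2)[unfolded config_polytope_def]])
      fix a assume "a \<in> config"
      then show "0 \<le> lin w a" using w length_verts by (auto simp: config_def lin_pt)
    qed
  qed
  then show ?case by auto
next
  case (Split f s t)
  show ?case
  proof (cases "0 \<le> lin f x")
    case True
    then show ?thesis using Split.IH(1)[of "f # p"] Split.prems by auto
  next
    case False
    then show ?thesis using Split.IH(2)[of "map uminus f # p"] Split.prems by (auto simp: lin_uminus)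
  qed
qed

text \<open>
  The roots of the trees leave no gap: some coordinate is minimal.
\<close>

lemma minimal_coordinate: "\<exists>(p, t)\<in>set orthants. \<forall>w\<in>set p. 0 \<le> lin w x"
proof -
  let ?x = "Poly_Mapping.lookup x"
  have "\<exists>i\<in>{..<5::nat}. \<forall>j\<in>{..<5}. ?x i \<le> ?x j"
    using ex_min_if_finite[of "?x ` {..<5}"] by (force simp: not_less)
  then obtain i where i: "i < 5" "\<And>j. j < 5 \<Longrightarrow> ?x i \<le> ?x j" by auto
  have le: "?x i \<le> ?x 0" "?x i \<le> ?x 1" "?x i \<le> ?x 2" "?x i \<le> ?x 3" "?x i \<le> ?x 4"
    using i(2) by auto
  have orth: "map fst orthants =
    [[[-1,1,0,0,0], [-1,0,1,0,0], [-1,0,0,1,0], [-1,0,0,0,1]],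
     [[1,-1,0,0,0], [0,-1,1,0,0], [0,-1,0,1,0], [0,-1,0,0,1]],
     [[1,0,-1,0,0], [0,1,-1,0,0], [0,0,-1,1,0], [0,0,-1,0,1]],
     [[1,0,0,-1,0], [0,1,0,-1,0], [0,0,1,-1,0], [0,0,0,-1,1]],
     [[1,0,0,0,-1], [0,1,0,0,-1], [0,0,1,0,-1], [0,0,0,1,-1]]]"
    by (simp add: orthants_def)
  have "i = 0 \<or> i = 1 \<or> i = 2 \<or> i = 3 \<or> i = 4" using i(1) by auto
  then have "\<exists>p\<in>set (map fst orthants). \<forall>w\<in>set p. 0 \<le> lin w x"
    unfolding orth using le
    by (elim disjE) (simp_all add: lin_def eval_nat_numeral lessThan_Suc)
  then obtain p where "p \<in> fst ` set orthants" "\<forall>w\<in>set p. 0 \<le> lin w x"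
    unfolding set_map by blast
  then show ?thesis by force
qed

lemma simplices_cover: 
  assumes "x \<in> config_polytope"
  shows "\<exists>c\<in>set cones. x \<in> convex hull (simplex_of c)"
proof -
  obtain p t where pt: "(p, t) \<in> set orthants" "\<forall>w\<in>set p. 0 \<le> lin w x"
    using minimal_coordinate[of x] by blast
  then obtain c where c: "c \<in> set (cones_of t)" "\<forall>(v, w)\<in>set c. 0 \<le> lin w x"
    using tree_certified_sound[OF _ assms] orthants_certified by blast
  then have "c \<in> set cones" using pt by (auto simp: cones_def)
  then show ?thesis
    using in_simplex[of c x] c(2) sum_lin_le_1[of c x] assms config_polytope_Rvecs by auto
qed

text \<open>
  A common point lies on the separating hyperplane, hence in the two faces that lie on it, and one of
  these is a face of both simplices.
\<close>

lemma separates_imp: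
  assumes c: "c \<in> set cones" and d: "d \<in> set cones" and f: "length f = 5" "separates f c d"
  shows "convex hull simplex_of c \<inter> convex hull simplex_of d \<subseteq> convex hull (simplex_of c \<inter> simplex_of d)"
proof
  fix x assume x: "x \<in> convex hull simplex_of c \<inter> convex hull simplex_of d"
  have lin_f: "lin f (pt v) = of_int (dot f v)" if "v \<in> fst ` set c \<or> v \<in> fst ` set d" for v
    using cone_entry[OF c] cone_entry[OF d] f(1) that by (intro lin_pt) auto
  have f0: "lin f 0 = 0" by (rule linear_0[OF linear_lin])
  have vertex: "a = 0 \<or> (\<exists>v\<in>fst ` set e. a = pt v)" if "a \<in> simplex_of e" for a e
    using that by (auto simp: simplex_of_def)
  have pos: "0 \<le> lin f a" if "a \<in> simplex_of c" for a
    using vertex[OF that]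
  proof
    assume "\<exists>v\<in>fst ` set c. a = pt v"
    then obtain v where v: "v \<in> fst ` set c" "a = pt v" by blast
    then have "0 \<le> dot f v" using f(2) unfolding separates_def by blast
    then show ?thesis using v lin_f[of v] by simp
  qed (simp add: f0)
  have neg: "0 \<le> - lin f a" if "a \<in> simplex_of d" for a
    using vertex[OF that]
  proof
    assume "\<exists>v\<in>fst ` set d. a = pt v"
    then obtain v where v: "v \<in> fst ` set d" "a = pt v" by blast
    then have "dot f v \<le> 0" using f(2) unfolding separates_def by blast
    then show ?thesis using v lin_f[of v] by simp
  qed (simp add: f0)
  have "0 \<le> lin f x"
    using linear_ge_on_convex_hull[OF linear_lin pos] x by auto
  moreover have "0 \<le> - lin f x"
    using linear_ge_on_convex_hull[OF linear_compose_neg[OF linear_lin] neg] x by auto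
  ultimately have x0: "lin f x = 0" by simp
  have "x \<in> convex hull {a \<in> simplex_of c. lin f a = 0}"
    using convex_hull_zero_part[OF finite_simplex[OF c] linear_lin, of f x] pos x x0 by auto
  moreover have "x \<in> convex hull {a \<in> simplex_of d. - lin f a = 0}"
    using convex_hull_zero_part[OF finite_simplex[OF d] linear_compose_neg[OF linear_lin], of f x] neg x x0 by auto
  moreover have "{a \<in> simplex_of c. lin f a = 0} \<subseteq> simplex_of d \<or> {a \<in> simplex_of d. - lin f a = 0} \<subseteq> simplex_of c"
    using f(2)[unfolded separates_def, THEN conjunct2, THEN conjunct2]
  proof
    assume *: "\<forall>v\<in>fst ` set c. dot f v = 0 \<longrightarrow> v \<in> fst ` set d"
    have "a \<in> simplex_of d" if "a \<in> simplex_of c" "lin f a = 0" for a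
      using vertex[OF that(1)] that(2) lin_f * unfolding simplex_of_def by force
    then show ?thesis by blast
  next
    assume *: "\<forall>v\<in>fst ` set d. dot f v = 0 \<longrightarrow> v \<in> fst ` set c"
    have "a \<in> simplex_of c" if "a \<in> simplex_of d" "- lin f a = 0" for a
      using vertex[OF that(1)] that(2) lin_f * unfolding simplex_of_def by force
    then show ?thesis by blast
  qed
  ultimately show "x \<in> convex hull (simplex_of c \<inter> simplex_of d)"
    using hull_mono[of "{a \<in> simplex_of c. lin f a = 0}" "simplex_of c \<inter> simplex_of d" convex]
      hull_mono[of "{a \<in> simplex_of d. - lin f a = 0}" "simplex_of c \<inter> simplex_of d" convex] by blast
qed

lemma simplices_meet:
  assumes c: "c \<in> set cones" and d: "d \<in> set cones"
  shows "convex hull simplex_of c \<inter> convex hull simplex_of d \<subseteq> convex hull (simplex_of c \<inter> simplex_of d)"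
proof -
  have len: "\<forall>f\<in>set separators. length f = 5" by (simp add: separators_def)
  obtain i j where ij: "i < length cones" "j < length cones" "c = cones ! i" "d = cones ! j"
    using c d by (auto simp: in_set_conv_nth)
  consider "i = j" | "i < j" | "j < i" by linarith
  then have "c = d \<or> (\<exists>f\<in>set separators. separates f c d \<or> separates f d c)"
    using cones_separated ij by cases (auto simp: sorted_wrt_iff_nth_less)
  then show ?thesis
    using separates_imp[OF c d] separates_imp[OF d c] len by (auto simp: Int_commute)
qed

definition config_triangulation :: "rvec set set" where
  "config_triangulation = {\<sigma>. \<exists>c\<in>set cones. \<sigma> \<subseteq> simplex_of c}"

lemma triangulation_of_config: "triangulation_of config_polytope config_triangulation"
  unfolding triangulation_of_def
proof (intro conjI ballI allI impI)
  have "config_triangulation \<subseteq> Pow config" using simplex_subset_config by (auto simp: config_triangulation_def)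
  then show "finite config_triangulation" using finite_config by (meson finite_Pow_iff finite_subset)
next
  fix \<sigma> assume "\<sigma> \<in> config_triangulation"
  then obtain c where c: "c \<in> set cones" "\<sigma> \<subseteq> simplex_of c" by (auto simp: config_triangulation_def)
  then show "finite \<sigma>" using finite_simplex finite_subset by blast
  show "\<sigma> \<subseteq> lattice_points config_polytope" using c simplex_subset_config lattice_points_config_polytope by auto
  show "\<not> affine_dependent \<sigma>"
    using c simplex_affine_independent affine_independent_subset by blast
next
  fix \<sigma> \<tau> assume "\<sigma> \<in> config_triangulation" "\<tau> \<subseteq> \<sigma>"
  then show "\<tau> \<in> config_triangulation" by (auto simp: config_triangulation_def)
next
  fix \<sigma> \<tau> assume "\<sigma> \<in> config_triangulation" "\<tau> \<in> config_triangulation"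
  then obtain c d where "c \<in> set cones" "\<sigma> \<subseteq> simplex_of c" "d \<in> set cones" "\<tau> \<subseteq> simplex_of d"
    by (auto simp: config_triangulation_def)
  then show "(convex hull \<sigma> \<inter> convex hull \<tau>) face_of convex hull \<sigma>"
    by (intro face_to_face[of "simplex_of c" "simplex_of d"] simplex_affine_independent finite_simplex simplices_meet)
next
  show "(\<Union>\<sigma>\<in>config_triangulation. convex hull \<sigma>) = config_polytope"
  proof
    show "(\<Union>\<sigma>\<in>config_triangulation. convex hull \<sigma>) \<subseteq> config_polytope"
      unfolding config_polytope_def using simplex_subset_config by (intro UN_least hull_mono) (auto simp: config_triangulation_def)
    show "config_polytope \<subseteq> (\<Union>\<sigma>\<in>config_triangulation. convex hull \<sigma>)"
      using simplices_cover by (fastforce simp: config_triangulation_def)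
  qed
qed

lemma unimodular_config: "unimodular 5 config_triangulation"
  unfolding unimodular_def
proof (intro ballI impI)
  fix \<sigma> assume "\<sigma> \<in> config_triangulation" and max: "\<forall>\<tau>\<in>config_triangulation. \<not> \<sigma> \<subset> \<tau>"
  then obtain c where c: "c \<in> set cones" "\<sigma> \<subseteq> simplex_of c" by (auto simp: config_triangulation_def)
  then have "\<sigma> = simplex_of c" using max by (auto simp: config_triangulation_def)
  then show "normalized_volume 5 (convex hull \<sigma>) = 1" using c normalized_volume_simplex by simp
qed

text \<open>
  The empty list of remaining vertices is the case in which the whole clique has been used to filter the
  faces, so that any face that is left contains it.
\<close>

lemma cliques_covered_sound:
  assumes "cliques_covered vs Fs" "K \<subseteq> set vs" "\<forall>u\<in>K. \<forall>v\<in>K. (u, v) \<notin> set nonedges"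
  shows "\<exists>F\<in>set Fs. K \<subseteq> set F"
  using assms
proof (induction vs Fs arbitrary: K rule: cliques_covered.induct)
  case (1 Fs)
  then show ?case by (cases Fs) auto
next
  case (2 v vs Fs)
  show ?case
  proof (cases "v \<in> K")
    case False
    then show ?thesis using 2 by (auto simp: subset_insert)
  next
    case True
    have "\<exists>F\<in>set (filter (\<lambda>F. v \<in> set F) Fs). K - {v} \<subseteq> set F"
      by (rule "2.IH"(2)) (use 2(3-5) True in auto)
    then show ?thesis using True by auto
  qed
qed

text \<open>
  If all pairs in \<open>M\<close> are edges, then \<open>M\<close> is a clique and hence a face. So a minimal nonface contains a
  non-edge, and it equals this non-edge by minimality.
\<close>

lemma flag_config_triangulation: "flag config_triangulation"
  unfolding flag_def
proof (intro allI impI)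
  fix M assume "minimal_nonface config_triangulation M"
  then have M: "M \<subseteq> \<Union>config_triangulation" "M \<notin> config_triangulation" "\<And>N. N \<subset> M \<Longrightarrow> N \<in> config_triangulation"
    by (auto simp: minimal_nonface_def)
  show "card M = 2"
  proof (rule ccontr)
    assume card: "card M \<noteq> 2"
    define K where "K = {v \<in> set (tl verts). pt v \<in> M}"
    have "\<Union>config_triangulation \<subseteq> config" using simplex_subset_config by (auto simp: config_triangulation_def)
    moreover have "set verts = insert [0, 0, 0, 0, 0] (set (tl verts))" by (simp add: verts_def)
    then have "config = insert 0 (pt ` set (tl verts))" by (simp add: config_def pt_zero)
    ultimately have "M \<subseteq> insert 0 (pt ` set (tl verts))" using M(1) by simp
    then have M_K: "M \<subseteq> insert 0 (pt ` K)" unfolding K_def by blast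
    have "\<forall>w\<in>set (tl verts). length w = 5 \<and> w \<noteq> [0, 0, 0, 0, 0]" by (simp add: verts_def)
    then have K: "length w = 5" "w \<noteq> [0, 0, 0, 0, 0]" if "w \<in> K" for w
      using that by (auto simp: K_def)
    have "(u, v) \<notin> set nonedges" if uv: "u \<in> K" "v \<in> K" for u v
    proof
      assume ne: "(u, v) \<in> set nonedges"
      have "{pt u, pt v} \<noteq> M"
      proof
        assume eq: "{pt u, pt v} = M"
        have "\<forall>(u, v)\<in>set nonedges. u \<noteq> v" by (simp add: nonedges_def)
        then have "u \<noteq> v" using ne by blast
        then have "pt u \<noteq> pt v" using uv K pt_inj by simp
        then show False using card eq by auto
      qed
      then have "{pt u, pt v} \<in> config_triangulation" using uv by (intro M(3)) (auto simp: K_def)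
      then obtain c where c: "c \<in> set cones" "pt u \<in> simplex_of c" "pt v \<in> simplex_of c"
        by (auto simp: config_triangulation_def)
      have "w \<in> fst ` set c" if wK: "w \<in> K" and wc: "pt w \<in> simplex_of c" for w
      proof -
        note w = K[OF wK]
        then have "pt w \<noteq> 0" using pt_inj[of w "[0, 0, 0, 0, 0]"] pt_zero by simp
        then obtain v where v: "v \<in> fst ` set c" "pt w = pt v" using wc by (auto simp: simplex_of_def)
        then have "w = v" using pt_inj[of w v] w(1) cone_entry[OF c(1)] by auto
        then show ?thesis using v(1) by simp
      qed
      then show False using nonedges_not_in_cones ne c uv by blast
    qed
    moreover have "K \<subseteq> set (tl verts)" by (auto simp: K_def)
    ultimately have "\<exists>F\<in>set (map (map fst) cones). K \<subseteq> set F"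
      by (intro cliques_covered_sound[OF cliques_covered_cones]) auto
    then obtain c where "c \<in> set cones" "K \<subseteq> fst ` set c" by auto
    then have "pt ` K \<subseteq> pt ` fst ` set c" by (intro image_mono)
    then have "M \<subseteq> simplex_of c" using M_K unfolding simplex_of_def by blast
    then have "M \<in> config_triangulation" using \<open>c \<in> set cones\<close> by (auto simp: config_triangulation_def)
    then show False using M(2) by simp
  qed
qed

section \<open>A cubic binomial that the quadrics do not generate\<close>

definition cycle_monomials :: "rvec multiset set" where
  "cycle_monomials = (\<lambda>t. image_mset pt (mset t)) ` set cycle_triples"

lemma cycle_triples_in_verts: "\<forall>t\<in>set cycle_triples. length t = 3 \<and> set t \<subseteq> set verts"
  by (simp add: cycle_triples_def verts_def)

text \<open>
  A quadratic move fixes one member \<open>a\<close> of a triple and replaces the other two by points \<open>b\<close>, \<open>c\<close> of the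
  configuration with the same sum; these are finitely many cases.
\<close>

lemma cycle_closed_under_quadratic_moves: "closed_under_quadratic_moves config cycle_monomials"
  unfolding closed_under_quadratic_moves_def
proof (intro allI impI, elim conjE)
  fix U Q Q'
  assume UQ: "U + Q \<in> cycle_monomials" and "size Q = 2" and Q': "set_mset Q' \<subseteq> config"
    and ex: "toric_exponent Q' = toric_exponent Q"
  then obtain t where t: "t \<in> set cycle_triples" "image_mset pt (mset t) = U + Q"
    by (auto simp: cycle_monomials_def)
  obtain U0 Q0 where t0: "mset t = U0 + Q0" "U = image_mset pt U0" "Q = image_mset pt Q0"
    using image_mset_eq_plusD[OF t(2)] by blast
  have "size U0 = 1"
    using arg_cong[OF t0(1), of size] \<open>size Q = 2\<close> cycle_triples_in_verts t(1) t0(3) by auto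
  then obtain a where a: "U0 = {#a#}" using size_1_singleton_mset by blast
  then have "a \<in> set t" using t0(1) by (metis add.commute mset_eq_setD set_mset_mset union_iff union_single_eq_member)
  have Q0: "Q0 = mset (remove1 a t)" using t0(1) a by simp
  have len2: "length (remove1 a t) = 2"
    using \<open>size Q = 2\<close> t0(3) Q0 by (metis size_image_mset size_mset)
  define b0 c0 where "b0 = remove1 a t ! 0" and "c0 = remove1 a t ! 1"
  have r: "remove1 a t = [b0, c0]"
    using len2 by (intro nth_equalityI) (auto simp: b0_def c0_def less_Suc_eq nth_Cons split: nat.splits)
  have bc0: "length b0 = 5" "length c0 = 5"
    using r cycle_triples_in_verts t(1) length_verts set_remove1_subset[of a t] by (auto simp del: set_remove1_subset)
  have "size Q' = 2" using ex \<open>size Q = 2\<close> by (simp add: toric_exponent_def)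
  then obtain x R where R: "Q' = add_mset x R"
    using size_eq_Suc_imp_eq_union[of Q' 1] by auto
  then obtain y where "R = {#y#}"
    using \<open>size Q' = 2\<close> size_1_singleton_mset[of R] by auto
  then have "Q' = {#x, y#}" using R by simp
  then obtain b c where bc: "b \<in> set verts" "c \<in> set verts" "Q' = {#pt b, pt c#}"
    using Q' by (auto simp: config_def)
  have "map2 (+) b c = map2 (+) b0 c0"
  proof (rule nth_equalityI)
    fix i assume i: "i < length (map2 (+) b c)"
    have "Poly_Mapping.map floor (pt b) + Poly_Mapping.map floor (pt c) =
        Poly_Mapping.map floor (pt b0) + Poly_Mapping.map floor (pt c0)"
      using ex by (simp add: toric_exponent_def bc(3) t0(3) Q0 r)
    from arg_cong[OF this, of "\<lambda>x. Poly_Mapping.lookup x i"]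
    show "map2 (+) b c ! i = map2 (+) b0 c0 ! i"
      using i length_verts[OF bc(1)] length_verts[OF bc(2)] bc0
      by (simp add: lookup_add lookup_pt Poly_Mapping.map.rep_eq when_def split: if_splits)
  qed (use bc bc0 length_verts in auto)
  then obtain s where s: "s \<in> set cycle_triples" "a \<in> set s" "b \<in> set (remove1 a s)" "remove1 b (remove1 a s) = [c]"
    using cycle_triples_closed t(1) \<open>a \<in> set t\<close> bc unfolding b0_def c0_def by blast
  have "mset xs = add_mset x (mset (remove1 x xs))" if "x \<in> set xs" for x and xs :: "int list list"
    using that by simp
  from this[OF s(2)] this[OF s(3)] have "mset s = {#a, b, c#}" using s(4) by simp
  then have "U + Q' = image_mset pt (mset s)" by (simp add: t0(2) a bc(3))
  then show "U + Q' \<in> cycle_monomials" using s(1) by (auto simp: cycle_monomials_def)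
qed

lemma toric_ideal_not_generated_by_quadrics:
  "\<not> generated_by_quadrics (lattice_points config_polytope) (toric_ideal config_polytope :: (rvec, 'k::field) mpoly set)"
proof -
  define e1 e3 e024 full where "e1 = pt [0,1,0,0,0]" and "e3 = pt [0,0,0,1,0]"
    and "e024 = pt [1,0,1,0,1]" and "full = pt [1,1,1,1,1]"
  define M where "M = {#e1, e3, e024#}"
  define N where "N = {#full, 0, 0#}"
  define p :: "(rvec, 'k) mpoly" where
    "p = Poly_Mapping.single (monomial M) 1 - Poly_Mapping.single (monomial N) 1"
  have MC: "M \<in> cycle_monomials"
    by (auto simp: cycle_monomials_def cycle_triples_def M_def e1_def e3_def e024_def)
  have "full \<notin># M'" if "M' \<in> cycle_monomials" for M'
    using that by (auto simp: cycle_monomials_def cycle_triples_def full_def pt_inj)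
  moreover have "full \<in># N" by (simp add: N_def)
  ultimately have NC: "N \<notin> cycle_monomials" by blast
  then have MN: "M \<noteq> N" using MC by auto
  have "0 \<in> config" "e1 \<in> config" "e3 \<in> config" "e024 \<in> config" "full \<in> config"
    using pt_zero by (force simp: config_def verts_def e1_def e3_def e024_def full_def)+
  then have ring: "p \<in> poly_ring config"
    using keys_diff[of "Poly_Mapping.single (monomial M) (1::'k)" "Poly_Mapping.single (monomial N) 1"]
    by (force simp: poly_ring_def p_def M_def N_def)
  have "Poly_Mapping.map floor (0 :: rvec) = 0"
    by (rule poly_mapping_eqI) (simp add: Poly_Mapping.map.rep_eq)
  then have ex: "toric_exponent M = toric_exponent N"
    unfolding toric_exponent_def M_def N_def e1_def e3_def e024_def full_def
    by (auto intro!: poly_mapping_eqI simp: lookup_add lookup_pt Poly_Mapping.map.rep_eq nth_Cons split: nat.splits)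
  have "subst_hom t_z p = 0"
  proof (rule poly_mapping_eqI)
    fix e
    have "Poly_Mapping.lookup (subst_hom t_z p) e =
        (\<Sum>L | L \<in> {M, N} \<and> toric_exponent L = e. Poly_Mapping.lookup p (monomial L))"
      using keys_diff[of "Poly_Mapping.single (monomial M) (1::'k)" "Poly_Mapping.single (monomial N) 1"]
      by (intro lookup_subst_hom) (auto simp: p_def)
    also have "\<dots> = 0"
    proof (cases "toric_exponent M = e")
      case True
      then have "{L \<in> {M, N}. toric_exponent L = e} = {M, N}" using ex by auto
      then have "(\<Sum>L | L \<in> {M, N} \<and> toric_exponent L = e. Poly_Mapping.lookup p (monomial L)) =
         (\<Sum>L\<in>{M, N}. Poly_Mapping.lookup p (monomial L))" by simp
      then show ?thesis using MN by (simp add: p_def lookup_minus lookup_single monomial_eq_iff)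
    next
      case False
      then have "{L \<in> {M, N}. toric_exponent L = e} = {}" using ex by auto
      then have "(\<Sum>L | L \<in> {M, N} \<and> toric_exponent L = e. Poly_Mapping.lookup p (monomial L)) =
         (\<Sum>L\<in>{}. Poly_Mapping.lookup p (monomial L))" by (simp only:)
      then show ?thesis by simp
    qed
    finally show "Poly_Mapping.lookup (subst_hom t_z p) e = Poly_Mapping.lookup 0 e" by simp
  qed
  then have "p \<in> toric_ideal config_polytope" using ring by (simp add: toric_ideal_def lattice_points_config_polytope)
  moreover have "(\<Sum>m\<in>monomial ` cycle_monomials. Poly_Mapping.lookup p m) = 1"
  proof -
    have "finite cycle_monomials" by (simp add: cycle_monomials_def)
    then have "(\<Sum>m\<in>monomial ` cycle_monomials. Poly_Mapping.lookup p m) =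
        (\<Sum>L\<in>cycle_monomials. if L = M then 1 else 0)"
      using NC by (intro sum.reindex_cong[of monomial])
        (auto simp: inj_on_def monomial_eq_iff p_def lookup_minus lookup_single when_def)
    then show ?thesis using MC \<open>finite cycle_monomials\<close> by simp
  qed
  ultimately show ?thesis
    using not_generated_by_quadrics[of cycle_monomials config_polytope p] cycle_closed_under_quadratic_moves lattice_points_config_polytope
    by (auto simp: cycle_monomials_def)
qed

theorem proposition1p4:
  shows "\<exists>d P. zero_one_polytope d P \<and>
           (\<exists>\<Delta>. triangulation_of P \<Delta> \<and> unimodular d \<Delta> \<and> flag \<Delta>) \<and>
           \<not> generated_by_quadrics (lattice_points P)
               (toric_ideal P :: (rvec, 'k::field) mpoly set)"
proof -
  have "zero_one_polytope 5 config_polytope"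
    using config_zero_one by (auto simp: zero_one_polytope_def config_polytope_def)
  then show ?thesis using triangulation_of_config unimodular_config flag_config_triangulation
      toric_ideal_not_generated_by_quadrics by blast
qed

end
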